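(* Let $f^0(x,y)$ be a curvature surface on $D=\{(x,y)\in\mathbb{R}^2:x>0\}$ and $F^0=[\phi,X^0_\alpha,X^0_\beta,\xi]$ the orthonormal frame field determining $f^0$. Let $\boldsymbol{u}(y)=(1+y^2)^{-1/2}(yX^0_\beta-\phi)(x,y)$ (independent of $x$), $\boldsymbol{f}(x,y)=((1+y^2)(5+4y^2))^{-1/2}(X^0_\beta-2(1+y^2)\xi+y\phi)(x,y)$, and let $A(y)$ be the $\mathbb{R}^4$-valued function with $f^0(x,y)=\frac{1}{2\sqrt5}\sqrt{\frac{5+4y^2}{1+y^2}}\,\boldsymbol{f}(x,y)+A(y)$. Then there is an orthonormal pair $(\boldsymbol{b}^\infty,\boldsymbol{c}^\infty)$ of constant vectors of $\mathbb{R}^4$ such that, with the circles $\boldsymbol{b}(u)$, $\boldsymbol{a}(u,y)$, $\Gamma(u,y)$ defined from it in the context: (1) The vector $\boldsymbol{u}(y)$ moves on the unit circle in the plane perpendicular to $\boldsymbol{b}^\infty$ and $\boldsymbol{c}^\infty$. Let $\boldsymbol{v}_1(y)$ be the vector determined by $\frac{d\boldsymbol{u}}{dy}=\frac{y^2}{1+y^2}\boldsymbol{v}_1(y)$. Then $[\boldsymbol{u}(y),\boldsymbol{v}_1(y),\boldsymbol{b}^\infty,\boldsymbol{c}^\infty]$ is an orthonormal frame field of $\mathbb{R}^4$ depending on $y$. (2) As $u\to\infty$, all $u$-curves $u\mapsto X^0_\alpha(e^{-u},y)$ uniformly converge to the circle $\boldsymbol{b}(u)$, and each $u$-curve $u\mapsto\boldsymbol{f}(e^{-u},y)$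 with fixed $y$ uniformly converges to the circle $\boldsymbol{a}(u,y)$. These convergences are also uniform with respect to $y\in\mathbb{R}$. In particular, the circles $\boldsymbol{a}(\cdot,y)$ deform continuously in $y$, and the circle $\boldsymbol{a}(\cdot,0)$ degenerates to one point. (3) Any $u$-curve $u\mapsto f^0(e^{-u},y)$ with fixed $y$ uniformly converges to the circle $\Gamma(u,y)$ as $u\to\infty$, and the convergence is also uniform with respect to $y\in\mathbb{R}$. In particular, the circles $\Gamma(\cdot,y)$ deform continuously in $y$, and the circle $\Gamma(\cdot,0)$ degenerates to one point.
   Context: $X_0(x)=\frac52+\sum_{k\ge1}a_kx^{2k}$ (analytic on $\mathbb{R}$), $a_1=1$, $2(k+1)(4k^2+\frac54)a_{k+1}+(2k-1)a_k=0$ $(k\ge1)$. $h(x,y)=2X_0-xX_0'+y^2\frac{X_0'}{x}+\sqrt5$ (positive). On $D$ put $a_1=\frac{2y}{xh}(X_0+\frac{\sqrt5}{2})$, $b_1=-\frac{1}{xh}(X_0+\frac{\sqrt5}{2}+\sqrt5(x^2-y^2))$, $c_1=-\frac{2}{xh}(X_0+\frac{\sqrt5}{2})$, $a_2=-\frac1h(2X_0+\sqrt5-(x^2+y^2)\frac{X_0'}{x})$, $b_2=-\frac{2y}{h}(\frac{X_0'}{2x}+\sqrt5)$, $c_2=\frac{2y}{h}(X_0''-\frac{X_0'}{x})$. The frame field is an analytic orthonormal frame field $F^0=[\phi,X^0_\alpha,X^0_\beta,\xi]$ of $\mathbb{R}^4$ on $D$ satisfying $\phi_x=-a_1X^0_\alpha$,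 $\xi_x=b_1X^0_\alpha$, $(X^0_\beta)_x=c_1X^0_\alpha$, $(X^0_\alpha)_x=a_1\phi-b_1\xi-c_1X^0_\beta$, $\phi_y=-a_2X^0_\beta$, $\xi_y=b_2X^0_\beta$, $(X^0_\alpha)_y=c_2X^0_\beta$, $(X^0_\beta)_y=a_2\phi-b_2\xi-c_2X^0_\alpha$ (it exists and is unique up to left multiplication by a constant orthogonal matrix). The curvature surface $f^0:D\to\mathbb{R}^4$ determined by $F^0$ is the analytic map, unique up to translation, with $df^0=\frac{x^2-y^2}{xh}X^0_\alpha dx+\frac{2y}{h}X^0_\beta dy$. With $h(0,y)=5+\sqrt5+2y^2$ put $v_2^0(y)=\frac{(5+4y^2)\frac{5+\sqrt5}{2}-\sqrt5y^2}{\sqrt{5+4y^2}\,h(0,y)}$, $v_3^0(y)=-\frac{2\sqrt5\,y^2}{h(0,y)}\sqrt{\frac{1+y^2}{5+4y^2}}$. Given $(\boldsymbol{b}^\infty,\boldsymbol{c}^\infty)$ and $\boldsymbol{v}_1(y)$ as in (1) ($\boldsymbol{v}_1$ continuous, which fixes $\boldsymbol{v}_1(0)$), put $\boldsymbol{b}(u)=\cos\frac{\sqrt5u}{2}\boldsymbol{b}^\infty-\sin\frac{\sqrt5u}{2}\boldsymbol{c}^\infty$, $\boldsymbol{v}_2(u)=-\sin\frac{\sqrt5u}{2}\boldsymbol{b}^\infty-\cos\frac{\sqrt5u}{2}\boldsymbol{c}^\infty$, $\boldsymbol{a}(u,y)=\frac{2}{\sqrt5}\big(-v_2^0(y)\boldsymbol{v}_1(y)+v_3^0(y)\boldsymbol{v}_2(u)\big)$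 (so $\boldsymbol{a}(u,0)=-\boldsymbol{v}_1(0)$), and $\Gamma(u,y)=\frac{1}{2\sqrt5}\sqrt{\frac{5+4y^2}{1+y^2}}\,\boldsymbol{a}(u,y)+A(y)$ (so $\Gamma(u,0)=-\frac12\boldsymbol{v}_1(0)+A(0)$). "$M(u,y)$ with fixed $y$ uniformly converges to $N(u,y)$ as $u\to\infty$" means: for every $\varepsilon>0$ there is $U$ with $\|M(u,y)-N(u,y)\|<\varepsilon$ for $u>U$; it is uniform with respect to $y\in\mathbb{R}$ if $U$ can be chosen independently of $y$. *)

theory Defs
  imports "HOL-Analysis.Analysis"
begin

type_synonym vec4 = "real ^ 4"

definition D :: "(real \<times> real) set" where
  "D = {(x, y). x > 0}"

definition real_analytic2_on ::
    "(real \<Rightarrow> real \<Rightarrow> 'a::real_normed_vector) \<Rightarrow> (real \<times> real) set \<Rightarrow> bool" where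
  "real_analytic2_on f S \<longleftrightarrow>
     (\<forall>(p, q) \<in> S. \<exists>r > 0. \<exists>c :: nat \<Rightarrow> nat \<Rightarrow> 'a. \<forall>x y. \<bar>x - p\<bar> < r \<longrightarrow> \<bar>y - q\<bar> < r \<longrightarrow>
        ((\<lambda>(m, n). ((x - p) ^ m * (y - q) ^ n) *\<^sub>R c m n) has_sum f x y) UNIV)"

text \<open>The coefficients of \<open>X\<^sub>0\<close>. The third equation is the recurrence
  \<open>2 (k + 1) (4 k\<^sup>2 + 5/4) a\<^sub>k\<^sub>+\<^sub>1 + (2 k - 1) a\<^sub>k = 0\<close>, \<open>k \<ge> 1\<close>, at index \<open>Suc k\<close>.\<close>

fun X0_coeff :: "nat \<Rightarrow> real" where
  "X0_coeff 0 = 5 / 2"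
| "X0_coeff (Suc 0) = 1"
| "X0_coeff (Suc (Suc k)) =
     - ((2 * real (Suc k) - 1) * X0_coeff (Suc k))
       / (2 * (real (Suc k) + 1) * (4 * (real (Suc k))\<^sup>2 + 5 / 4))"

definition X0 :: "real \<Rightarrow> real" where
  "X0 x = (\<Sum>k. X0_coeff k * x ^ (2 * k))"

abbreviation X0' :: "real \<Rightarrow> real" where "X0' \<equiv> deriv X0"
abbreviation X0'' :: "real \<Rightarrow> real" where "X0'' \<equiv> deriv (deriv X0)"

definition h :: "real \<Rightarrow> real \<Rightarrow> real" where
  "h x y = 2 * X0 x - x * X0' x + y\<^sup>2 * (X0' x / x) + sqrt 5"

definition a1 :: "real \<Rightarrow> real \<Rightarrow> real" where
  "a1 x y = 2 * y / (x * h x y) * (X0 x + sqrt 5 / 2)"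

definition b1 :: "real \<Rightarrow> real \<Rightarrow> real" where
  "b1 x y = - (1 / (x * h x y)) * (X0 x + sqrt 5 / 2 + sqrt 5 * (x\<^sup>2 - y\<^sup>2))"

definition c1 :: "real \<Rightarrow> real \<Rightarrow> real" where
  "c1 x y = - (2 / (x * h x y)) * (X0 x + sqrt 5 / 2)"

definition a2 :: "real \<Rightarrow> real \<Rightarrow> real" where
  "a2 x y = - (1 / h x y) * (2 * X0 x + sqrt 5 - (x\<^sup>2 + y\<^sup>2) * (X0' x / x))"

definition b2 :: "real \<Rightarrow> real \<Rightarrow> real" where
  "b2 x y = - (2 * y / h x y) * (X0' x / (2 * x) + sqrt 5)"

definition c2 :: "real \<Rightarrow> real \<Rightarrow> real" where
  "c2 x y = 2 * y / h x y * (X0'' x - X0' x / x)"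

definition orthonormal4 :: "vec4 \<Rightarrow> vec4 \<Rightarrow> vec4 \<Rightarrow> vec4 \<Rightarrow> bool" where
  "orthonormal4 p q r s \<longleftrightarrow>
     norm p = 1 \<and> norm q = 1 \<and> norm r = 1 \<and> norm s = 1 \<and>
     p \<bullet> q = 0 \<and> p \<bullet> r = 0 \<and> p \<bullet> s = 0 \<and> q \<bullet> r = 0 \<and> q \<bullet> s = 0 \<and> r \<bullet> s = 0"

definition frame_field ::
    "(real \<Rightarrow> real \<Rightarrow> vec4) \<Rightarrow> (real \<Rightarrow> real \<Rightarrow> vec4) \<Rightarrow> (real \<Rightarrow> real \<Rightarrow> vec4) \<Rightarrow> (real \<Rightarrow> real \<Rightarrow> vec4) \<Rightarrow> bool"
where
  "frame_field \<phi> Xa Xb \<xi> \<longleftrightarrow>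
     real_analytic2_on \<phi> D \<and> real_analytic2_on Xa D \<and> real_analytic2_on Xb D \<and> real_analytic2_on \<xi> D \<and>
     (\<forall>(x, y) \<in> D.
        orthonormal4 (\<phi> x y) (Xa x y) (Xb x y) (\<xi> x y) \<and>
        ((\<lambda>s. \<phi> s y) has_vector_derivative (- a1 x y *\<^sub>R Xa x y)) (at x) \<and>
        ((\<lambda>s. \<xi> s y) has_vector_derivative (b1 x y *\<^sub>R Xa x y)) (at x) \<and>
        ((\<lambda>s. Xb s y) has_vector_derivative (c1 x y *\<^sub>R Xa x y)) (at x) \<and>
        ((\<lambda>s. Xa s y) has_vector_derivative
           (a1 x y *\<^sub>R \<phi> x y - b1 x y *\<^sub>R \<xi> x y - c1 x y *\<^sub>R Xb x y)) (at x) \<and>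
        ((\<lambda>t. \<phi> x t) has_vector_derivative (- a2 x y *\<^sub>R Xb x y)) (at y) \<and>
        ((\<lambda>t. \<xi> x t) has_vector_derivative (b2 x y *\<^sub>R Xb x y)) (at y) \<and>
        ((\<lambda>t. Xa x t) has_vector_derivative (c2 x y *\<^sub>R Xb x y)) (at y) \<and>
        ((\<lambda>t. Xb x t) has_vector_derivative
           (a2 x y *\<^sub>R \<phi> x y - b2 x y *\<^sub>R \<xi> x y - c2 x y *\<^sub>R Xa x y)) (at y))"

text \<open>The second condition says that the differential of \<open>f\<close> is
  \<open>(x\<^sup>2 - y\<^sup>2) / (x h) Xa dx + (2 y / h) Xb dy\<close>.\<close>

definition curvature_surface ::
    "(real \<Rightarrow> real \<Rightarrow> vec4) \<Rightarrow> (real \<Rightarrow> real \<Rightarrow> vec4) \<Rightarrow> (real \<Rightarrow> real \<Rightarrow> vec4) \<Rightarrow> bool" where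
  "curvature_surface Xa Xb f \<longleftrightarrow>
     real_analytic2_on f D \<and>
     (\<forall>(x, y) \<in> D.
        ((\<lambda>(s, t). f s t) has_derivative
           (\<lambda>(dx, dy). (dx * ((x\<^sup>2 - y\<^sup>2) / (x * h x y))) *\<^sub>R Xa x y
                       + (dy * (2 * y / h x y)) *\<^sub>R Xb x y)) (at (x, y)))"

definition u_vec :: "(real \<Rightarrow> real \<Rightarrow> vec4) \<Rightarrow> (real \<Rightarrow> real \<Rightarrow> vec4) \<Rightarrow> real \<Rightarrow> real \<Rightarrow> vec4" where
  "u_vec \<phi> Xb x y = (1 / sqrt (1 + y\<^sup>2)) *\<^sub>R (y *\<^sub>R Xb x y - \<phi> x y)"

definition f_vec ::
    "(real \<Rightarrow> real \<Rightarrow> vec4) \<Rightarrow> (real \<Rightarrow> real \<Rightarrow> vec4) \<Rightarrow> (real \<Rightarrow> real \<Rightarrow> vec4) \<Rightarrow> real \<Rightarrow> real \<Rightarrow> vec4" where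
  "f_vec \<phi> Xb \<xi> x y =
     (1 / sqrt ((1 + y\<^sup>2) * (5 + 4 * y\<^sup>2))) *\<^sub>R (Xb x y - (2 * (1 + y\<^sup>2)) *\<^sub>R \<xi> x y + y *\<^sub>R \<phi> x y)"

definition scale :: "real \<Rightarrow> real" where
  "scale y = 1 / (2 * sqrt 5) * sqrt ((5 + 4 * y\<^sup>2) / (1 + y\<^sup>2))"

text \<open>\<open>h0 y\<close> is the value of \<open>h\<close> at \<open>x = 0\<close> in the sense of analytic continuation
  (\<open>X0' x / x\<close> tends to 2 there); the Isabelle term \<open>h 0 y\<close> involves \<open>X0' 0 / 0 = 0\<close>
  and is not this value.\<close>

definition h0 :: "real \<Rightarrow> real" where
  "h0 y = 5 + sqrt 5 + 2 * y\<^sup>2"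

definition v2_0 :: "real \<Rightarrow> real" where
  "v2_0 y = ((5 + 4 * y\<^sup>2) * ((5 + sqrt 5) / 2) - sqrt 5 * y\<^sup>2) / (sqrt (5 + 4 * y\<^sup>2) * h0 y)"

definition v3_0 :: "real \<Rightarrow> real" where
  "v3_0 y = - (2 * sqrt 5 * y\<^sup>2 / h0 y) * sqrt ((1 + y\<^sup>2) / (5 + 4 * y\<^sup>2))"

definition b_circ :: "vec4 \<Rightarrow> vec4 \<Rightarrow> real \<Rightarrow> vec4" where
  "b_circ b c u = cos (sqrt 5 * u / 2) *\<^sub>R b - sin (sqrt 5 * u / 2) *\<^sub>R c"

definition v2_vec :: "vec4 \<Rightarrow> vec4 \<Rightarrow> real \<Rightarrow> vec4" where
  "v2_vec b c u = - sin (sqrt 5 * u / 2) *\<^sub>R b - cos (sqrt 5 * u / 2) *\<^sub>R c"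

definition a_circ :: "vec4 \<Rightarrow> vec4 \<Rightarrow> (real \<Rightarrow> vec4) \<Rightarrow> real \<Rightarrow> real \<Rightarrow> vec4" where
  "a_circ b c v1 u y = (2 / sqrt 5) *\<^sub>R (- v2_0 y *\<^sub>R v1 y + v3_0 y *\<^sub>R v2_vec b c u)"

definition Gamma_circ ::
    "vec4 \<Rightarrow> vec4 \<Rightarrow> (real \<Rightarrow> vec4) \<Rightarrow> (real \<Rightarrow> vec4) \<Rightarrow> real \<Rightarrow> real \<Rightarrow> vec4" where
  "Gamma_circ b c v1 A u y = scale y *\<^sub>R a_circ b c v1 u y + A y"

definition is_circle :: "vec4 set \<Rightarrow> bool" where
  "is_circle S \<longleftrightarrow>
     (\<exists>m p q r. r > 0 \<and> norm p = 1 \<and> norm q = 1 \<and> p \<bullet> q = 0 \<and>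
        S = range (\<lambda>t. m + (r * cos t) *\<^sub>R p + (r * sin t) *\<^sub>R q))"

text \<open>Convergence of a family of \<open>u\<close>-curves, indexed by \<open>y\<close>, to a family of \<open>u\<close>-curves as
  \<open>u \<rightarrow> \<infinity>\<close>: for one fixed \<open>y\<close>, and uniformly in \<open>y\<close>.\<close>

definition u_curve_converges ::
    "(real \<Rightarrow> real \<Rightarrow> vec4) \<Rightarrow> (real \<Rightarrow> real \<Rightarrow> vec4) \<Rightarrow> real \<Rightarrow> bool" where
  "u_curve_converges M N y \<longleftrightarrow> (\<forall>\<epsilon> > 0. \<exists>U. \<forall>u > U. norm (M u y - N u y) < \<epsilon>)"

definition u_curves_converge_uniformly ::
    "(real \<Rightarrow> real \<Rightarrow> vec4) \<Rightarrow> (real \<Rightarrow> real \<Rightarrow> vec4) \<Rightarrow> bool" where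
  "u_curves_converge_uniformly M N \<longleftrightarrow> (\<forall>\<epsilon> > 0. \<exists>U. \<forall>u > U. \<forall>y. norm (M u y - N u y) < \<epsilon>)"

text \<open>Continuity in \<open>y\<close> of the curves \<open>u \<mapsto> N u y\<close> with respect to the supremum distance.\<close>

definition deforms_continuously :: "(real \<Rightarrow> real \<Rightarrow> vec4) \<Rightarrow> bool" where
  "deforms_continuously N \<longleftrightarrow> (\<forall>y0. uniform_limit UNIV (\<lambda>y u. N u y) (\<lambda>u. N u y0) (at y0))"

end

theory Submission
  imports Defs "HOL-Real_Asymp.Real_Asymp"
begin

text \<open>
  Put \<open>Z = X0'/x\<close>. The recurrence for the coefficients is an ODE for \<open>X0\<close>, which has the first
  integral \<open>5 Z\<^sup>2 - 8 X0 Z + 4 x\<^sup>2 Z\<^sup>2 + 4 (x Z')\<^sup>2 + 20 = 0\<close>; this is exactly the condition that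
  \<open>(1 + y\<^sup>2) / y\<^sup>2\<close> times \<open>d\<^bold>u/dy\<close> is a unit vector.

  The vectors \<open>Xa\<close>, \<open>\<xi>\<close> and \<open>w = (1 + y\<^sup>2)\<^sup>-\<^sup>1\<^sup>/\<^sup>2 (Xb + y \<phi>)\<close> span the complement of \<open>\<^bold>u\<close>. As \<open>x\<close> tends to 0,
  \<open>Xa\<close> and a combination \<open>Q\<close> of \<open>w\<close> and \<open>\<xi>\<close> with coefficients depending only on \<open>y\<close> satisfy
  \<open>x Xa\<^sub>x = (\<surd>5/2) Q + O(x\<^sup>2)\<close> and \<open>x Q\<^sub>x = - (\<surd>5/2) Xa + O(x\<^sup>2)\<close>, uniformly in \<open>y\<close>. Rotating the
  pair \<open>(Xa, Q)\<close> back by the angle \<open>(\<surd>5/2) ln x\<close> therefore gives vectors that converge; the limits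
  do not depend on \<open>y\<close> because \<open>Xa\<^sub>y = O(x\<^sup>2)\<close>, and they are \<open>b\<close> and \<open>c\<close>. The vector \<open>f_vec\<close> is a
  combination of \<open>Q\<close> and of a vector converging to \<open>v1\<close>, and \<open>f0 - scale f_vec\<close> has vanishing
  \<open>x\<close>-derivative.
\<close>

section \<open>Power series, differential equation and first integral of \<open>X0\<close>\<close>

section \<open>The function X0\<close>

text \<open>The starting values \<open>5 / 2\<close> and \<open>1\<close> satisfy the recurrence at
  \<open>k = 0\<close> as well, so the differential equation below has no inhomogeneous
  term.\<close>

lemma X0_coeff_recurrence:
  "2 * (real k + 1) * (4 * (real k)\<^sup>2 + 5 / 4) * X0_coeff (Suc k) + (2 * real k - 1) * X0_coeff k = 0"
proof (cases k)
  case (Suc j)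
  have "4 * (real (Suc j))\<^sup>2 + 5 / 4 > 0" by (simp add: add_nonneg_pos)
  then have "2 * (real (Suc j) + 1) * (4 * (real (Suc j))\<^sup>2 + 5 / 4) \<noteq> 0" by simp
  then show ?thesis
    unfolding Suc X0_coeff.simps(3) by (simp only: nonzero_mult_div_cancel_left times_divide_eq_right)
      simp
qed simp

text \<open>Since \<open>2 * k \<le> k^2 + 1\<close>, consecutive coefficients have a ratio of
  absolute value at most \<open>1 / (k + 1)\<close>. Comparison with the exponential series then
  gives convergence on the whole line.\<close>

lemma abs_X0_coeff_le: "\<bar>X0_coeff k\<bar> \<le> 5 / 2 / fact k"
proof (induction k)
  case (Suc k)
  define d where "d = 2 * (4 * (real k)\<^sup>2 + 5 / 4)"
  have d: "d > 0" by (simp add: d_def add_nonneg_pos)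
  have "2 * real k \<le> (real k)\<^sup>2 + 1"
    using sum_squares_bound[of "real k" 1] by simp
  then have "\<bar>2 * real k - 1\<bar> \<le> 8 * (real k)\<^sup>2 + 5 / 2"
    using zero_le_power2[of "real k"] of_nat_0_le_iff[of k, where 'a = real] by linarith
  then have "\<bar>2 * real k - 1\<bar> \<le> d"
    by (simp add: d_def)
  then have r: "\<bar>2 * real k - 1\<bar> / d \<le> 1" using d by simp
  have "(real k + 1) * d * X0_coeff (Suc k) = - ((2 * real k - 1) * X0_coeff k)"
    using X0_coeff_recurrence[of k] by (simp add: d_def algebra_simps add_divide_distrib)
  then have "X0_coeff (Suc k) = - ((2 * real k - 1) * X0_coeff k) / ((real k + 1) * d)"
    using d nonzero_mult_div_cancel_left[of "(real k + 1) * d" "X0_coeff (Suc k)"]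
    by (simp add: add_nonneg_eq_0_iff del: X0_coeff.simps)
  then have "\<bar>X0_coeff (Suc k)\<bar> = \<bar>2 * real k - 1\<bar> / d * (\<bar>X0_coeff k\<bar> / (real k + 1))"
    using d by (simp add: abs_mult abs_divide)
  also have "\<dots> \<le> 1 * (5 / 2 / fact k / (real k + 1))"
    using r Suc by (intro mult_mono divide_right_mono) auto
  also have "\<dots> = 5 / 2 / fact (Suc k)"
    by (simp add: field_simps)
  finally show ?case .
qed simp

text \<open>Termwise differentiation for everywhere convergent series. The third fact describes the
  Euler operator \<open>x d/dx\<close>, which multiplies the n-th coefficient by \<open>n\<close>
  and so turns the polynomial factors of the recurrence into derivatives.\<close>

lemma entire_power_series:
  fixes c :: "nat \<Rightarrow> real"
  assumes "\<And>x. summable (\<lambda>n. c n * x ^ n)"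
  shows summable_diffs_entire: "summable (\<lambda>n. diffs c n * x ^ n)"
    and has_derivative_entire:
      "((\<lambda>x. \<Sum>n. c n * x ^ n) has_real_derivative (\<Sum>n. diffs c n * x ^ n)) (at x)"
    and Euler_operator_sums:
      "(\<lambda>n. real n * c n * x ^ n) sums (x * (\<Sum>n. diffs c n * x ^ n))"
proof -
  show s: "summable (\<lambda>n. diffs c n * x ^ n)"
    by (rule termdiff_converges_all) (use assms in auto)
  show "((\<lambda>x. \<Sum>n. c n * x ^ n) has_real_derivative (\<Sum>n. diffs c n * x ^ n)) (at x)"
    by (rule termdiffs_strong_converges_everywhere) (use assms in auto)
  have "(\<lambda>n. x * (real n * c n * x ^ (n - Suc 0))) sums (x * (\<Sum>n. diffs c n * x ^ n))"
    using diffs_equiv[OF s] by (intro sums_mult) simp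
  moreover have "x * (real n * c n * x ^ (n - Suc 0)) = real n * c n * x ^ n" for n
    by (cases n) simp_all
  ultimately show "(\<lambda>n. real n * c n * x ^ n) sums (x * (\<Sum>n. diffs c n * x ^ n))"
    by simp
qed

text \<open>\<open>X0\<close> is even, so it is studied as a function of \<open>t = x^2\<close>. In
  this variable \<open>X0' x / x\<close> becomes \<open>2 * F1 t\<close>, with no division left, and
  errors linear in \<open>t\<close> are quadratic in \<open>x\<close>.\<close>

definition F :: "real \<Rightarrow> real" where
  "F t = (\<Sum>n. X0_coeff n * t ^ n)"

definition F1 :: "real \<Rightarrow> real" where
  "F1 t = (\<Sum>n. diffs X0_coeff n * t ^ n)"

definition F2 :: "real \<Rightarrow> real" where
  "F2 t = (\<Sum>n. diffs (diffs X0_coeff) n * t ^ n)"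

definition F3 :: "real \<Rightarrow> real" where
  "F3 t = (\<Sum>n. diffs (diffs (diffs X0_coeff)) n * t ^ n)"

lemma summable_F: "summable (\<lambda>n. X0_coeff n * t ^ n)"
proof (rule summable_comparison_test')
  show "summable (\<lambda>n. 5 / 2 * (inverse (fact n) * \<bar>t\<bar> ^ n))"
    by (intro summable_mult summable_exp)
  show "norm (X0_coeff n * t ^ n) \<le> 5 / 2 * (inverse (fact n) * \<bar>t\<bar> ^ n)" for n
    using mult_right_mono[OF abs_X0_coeff_le[of n], of "\<bar>t\<bar> ^ n"]
    by (simp add: abs_mult power_abs field_simps)
qed

lemma summable_F1: "summable (\<lambda>n. diffs X0_coeff n * t ^ n)"
  by (rule summable_diffs_entire[OF summable_F])

lemma summable_F2: "summable (\<lambda>n. diffs (diffs X0_coeff) n * t ^ n)"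
  by (rule summable_diffs_entire[OF summable_F1])

lemma DERIV_F: "(F has_real_derivative F1 t) (at t)"
  using has_derivative_entire[OF summable_F] by (simp add: F_def[abs_def] F1_def)

lemma DERIV_F1: "(F1 has_real_derivative F2 t) (at t)"
  using has_derivative_entire[OF summable_F1] by (simp add: F1_def[abs_def] F2_def)

lemma DERIV_F2: "(F2 has_real_derivative F3 t) (at t)"
  using has_derivative_entire[OF summable_F2] by (simp add: F2_def[abs_def] F3_def)

lemma F_0: "F 0 = 5 / 2" and F1_0: "F1 0 = 1"
  using powser_zero[of X0_coeff] powser_zero[of "diffs X0_coeff"]
  by (simp_all add: F_def F1_def diffs_def)

text \<open>The coefficient of \<open>t^n\<close> on the left is exactly the recurrence at
  \<open>n\<close>. The factor \<open>n^2\<close> comes from applying the Euler operator twice to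
  \<open>F1\<close>, which gives \<open>t * (F2 t + t * F3 t)\<close>.\<close>

lemma F_ode: "8 * t * (F2 t + t * F3 t) + 5 / 2 * F1 t + 2 * t * F1 t - F t = 0"
proof -
  define g where "g = diffs X0_coeff"
  have P: "(\<lambda>n. real n * g n * s ^ n) sums (s * F2 s)" for s
    unfolding g_def F2_def by (rule Euler_operator_sums[OF summable_F1])
  have P_eq: "(\<lambda>s. \<Sum>n. real n * g n * s ^ n) = (\<lambda>s. s * F2 s)"
    using P by (auto simp: sums_iff)
  have P_summable: "summable (\<lambda>n. real n * g n * s ^ n)" for s
    using P by (simp add: sums_iff)
  \<comment> \<open>Differentiating \<open>s * F2 s\<close> both termwise and by the product rule
    gives a closed form for the termwise derivative, so the Euler operator can be applied a second
    time.\<close>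
  have "((\<lambda>s. s * F2 s) has_real_derivative (\<Sum>n. diffs (\<lambda>n. real n * g n) n * t ^ n)) (at t)"
    using has_derivative_entire[OF P_summable] by (simp add: P_eq)
  moreover have "((\<lambda>s. s * F2 s) has_real_derivative (F2 t + t * F3 t)) (at t)"
    by (auto intro!: derivative_eq_intros DERIV_F2)
  ultimately have "(\<Sum>n. diffs (\<lambda>n. real n * g n) n * t ^ n) = F2 t + t * F3 t"
    by (rule DERIV_unique)
  then have Q: "(\<lambda>n. real n * (real n * g n) * t ^ n) sums (t * (F2 t + t * F3 t))"
    using Euler_operator_sums[OF P_summable] by metis
  have R: "(\<lambda>n. g n * t ^ n) sums F1 t"
    unfolding g_def F1_def using summable_F1 by (rule summable_sums)
  have S: "(\<lambda>n. real n * X0_coeff n * t ^ n) sums (t * F1 t)"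
    unfolding F1_def by (rule Euler_operator_sums[OF summable_F])
  have T: "(\<lambda>n. X0_coeff n * t ^ n) sums F t"
    unfolding F_def using summable_F by (rule summable_sums)
  have "(\<lambda>n. 8 * (real n * (real n * g n) * t ^ n) + 5 / 2 * (g n * t ^ n)
            + 2 * (real n * X0_coeff n * t ^ n) - X0_coeff n * t ^ n)
        sums (8 * (t * (F2 t + t * F3 t)) + 5 / 2 * F1 t + 2 * (t * F1 t) - F t)"
    by (intro sums_diff sums_add sums_mult P Q R S T)
  moreover have "8 * (real n * (real n * g n) * t ^ n) + 5 / 2 * (g n * t ^ n)
            + 2 * (real n * X0_coeff n * t ^ n) - X0_coeff n * t ^ n
        = (2 * (real n + 1) * (4 * (real n)\<^sup>2 + 5 / 4) * X0_coeff (Suc n)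
           + (2 * real n - 1) * X0_coeff n) * t ^ n" for n
    unfolding g_def diffs_def by (simp add: algebra_simps power2_eq_square)
  ultimately have "(\<lambda>n. 0) sums (8 * (t * (F2 t + t * F3 t)) + 5 / 2 * F1 t + 2 * (t * F1 t) - F t)"
    by (simp only: X0_coeff_recurrence mult_zero_left)
  then show ?thesis
    using sums_unique2[OF sums_zero] by fastforce
qed

text \<open>The derivative of the left side is \<open>4 * F2\<close> times the left side of
  \<open>F_ode\<close>, so it vanishes. The constant value is read off at \<open>t = 0\<close>,
  where it is \<open>5 - 10 + 5\<close>.\<close>

lemma F_first_integral:
  "5 * (F1 t)\<^sup>2 - 4 * F t * F1 t + 4 * t * (F1 t)\<^sup>2 + 16 * (t * F2 t)\<^sup>2 + 5 = 0"
proof -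
  define E where "E t = 5 * (F1 t)\<^sup>2 - 4 * F t * F1 t + 4 * t * (F1 t)\<^sup>2 + 16 * (t * F2 t)\<^sup>2 + 5" for t
  have "(E has_real_derivative
      4 * F2 s * (8 * s * (F2 s + s * F3 s) + 5 / 2 * F1 s + 2 * s * F1 s - F s)) (at s)" for s
    unfolding E_def
    by (auto intro!: derivative_eq_intros DERIV_F DERIV_F1 DERIV_F2
        simp: power2_eq_square algebra_simps)
  then have "(E has_real_derivative 0) (at s)" for s
    by (simp only: F_ode mult_zero_right)
  then have "E t = E 0"
    by (intro DERIV_isconst_all) auto
  also have "E 0 = 0"
    by (simp add: E_def F_0 F1_0)
  finally show ?thesis by (simp add: E_def)
qed

section \<open>Return to the variable \<open>x\<close>: the functions \<open>Z\<close> and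
  \<open>W\<close> and their behaviour near 0\<close>

lemma X0_eq: "X0 x = F (x\<^sup>2)"
  by (simp add: X0_def F_def power_mult)

lemma deriv_X0: "X0' = (\<lambda>x. 2 * x * F1 (x\<^sup>2))"
proof
  fix x
  have "((\<lambda>x. F (x\<^sup>2)) has_real_derivative F1 (x\<^sup>2) * (2 * x)) (at x)"
    by (auto intro!: derivative_eq_intros DERIV_chain2[OF DERIV_F])
  then show "X0' x = 2 * x * F1 (x\<^sup>2)"
    by (simp add: X0_eq[abs_def] DERIV_imp_deriv)
qed

lemma deriv2_X0: "X0'' x = 2 * F1 (x\<^sup>2) + 4 * x\<^sup>2 * F2 (x\<^sup>2)"
proof -
  have "((\<lambda>x. 2 * x * F1 (x\<^sup>2)) has_real_derivative 2 * F1 (x\<^sup>2) + 4 * x\<^sup>2 * F2 (x\<^sup>2)) (at x)"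
    by (auto intro!: derivative_eq_intros DERIV_chain2[OF DERIV_F1] simp: power2_eq_square)
  then show ?thesis
    by (simp add: deriv_X0 DERIV_imp_deriv)
qed

text \<open>By the convention for division by zero, \<open>Z 0 = 0\<close>, whereas the limit at 0
  is 2. Hence the identities for \<open>Z\<close> are stated for
  \<open>x \<noteq> 0\<close>.\<close>

definition Z :: "real \<Rightarrow> real" where "Z x = X0' x / x"

text \<open>\<open>W x\<close> is \<open>x Z' x\<close>.\<close>

definition W :: "real \<Rightarrow> real" where "W x = X0'' x - X0' x / x"

lemma Z_eq: "x \<noteq> 0 \<Longrightarrow> Z x = 2 * F1 (x\<^sup>2)"
  by (simp add: Z_def deriv_X0)

lemma W_eq: "x \<noteq> 0 \<Longrightarrow> W x = 4 * x\<^sup>2 * F2 (x\<^sup>2)"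
  by (simp only: W_def deriv2_X0) (simp add: deriv_X0)

lemma first_integral:
  assumes "x \<noteq> 0"
  shows "5 * (Z x)\<^sup>2 - 8 * X0 x * Z x + 4 * x\<^sup>2 * (Z x)\<^sup>2 + 4 * (W x)\<^sup>2 + 20 = 0"
  using F_first_integral[of "x\<^sup>2"] assms
  by (simp add: Z_eq W_eq X0_eq power_mult_distrib algebra_simps)

lemma h_eq: "x \<noteq> 0 \<Longrightarrow> h x y = 2 * X0 x + sqrt 5 - x\<^sup>2 * Z x + y\<^sup>2 * Z x"
  by (simp add: h_def Z_def power2_eq_square)

lemma linear_bound_near_0:
  fixes g :: "real \<Rightarrow> real"
  assumes "\<And>t. (g has_real_derivative g' t) (at t)" and "\<And>t. isCont g' t"
  shows "\<exists>K>0. \<forall>t\<in>{0..1}. \<bar>g t - g 0\<bar> \<le> K * t"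
proof -
  have "compact (g' ` {0..1})"
    by (intro compact_continuous_image continuous_at_imp_continuous_on) (use assms(2) in auto)
  then obtain K where K: "K > 0" "\<And>t. t \<in> {0..1} \<Longrightarrow> \<bar>g' t\<bar> \<le> K"
    using compact_imp_bounded bounded_pos by (metis (full_types) imageI real_norm_def)
  have "\<bar>g t - g 0\<bar> \<le> K * t" if "t \<in> {0..1}" for t
    using field_differentiable_bound[of "{0..1}" g g' K t 0] that K assms(1)
    by (auto intro: DERIV_subset)
  then show ?thesis using K(1) by blast
qed

text \<open>In the variable \<open>t = x^2\<close> these are mean value bounds on
  \<open>[0,1]\<close> for \<open>F\<close> and \<open>F1\<close>, and for \<open>W\<close>
  boundedness of \<open>F2\<close> together with the explicit factor \<open>x^2\<close>.\<close>

lemma X0_expansion_near_0: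
  "\<exists>K>0. \<forall>x. 0 < x \<and> x \<le> 1 \<longrightarrow>
     \<bar>X0 x - 5 / 2\<bar> \<le> K * x\<^sup>2 \<and> \<bar>Z x - 2\<bar> \<le> K * x\<^sup>2 \<and> \<bar>W x\<bar> \<le> K * x\<^sup>2"
proof -
  obtain K1 where K1: "K1 > 0" "\<forall>t\<in>{0..1}. \<bar>F t - 5 / 2\<bar> \<le> K1 * t"
    using linear_bound_near_0[OF DERIV_F] DERIV_F1 by (auto simp: F_0 intro: DERIV_isCont)
  obtain K2 where K2: "K2 > 0" "\<forall>t\<in>{0..1}. \<bar>F1 t - 1\<bar> \<le> K2 * t"
    using linear_bound_near_0[OF DERIV_F1] DERIV_F2 by (auto simp: F1_0 intro: DERIV_isCont)
  have "compact (F2 ` {0..1})"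
    by (intro compact_continuous_image continuous_at_imp_continuous_on)
      (use DERIV_F2 DERIV_isCont in blast)+
  then obtain K3 where K3: "K3 > 0" "\<And>t. t \<in> {0..1} \<Longrightarrow> \<bar>F2 t\<bar> \<le> K3"
    using compact_imp_bounded bounded_pos by (metis (full_types) imageI real_norm_def)
  define K where "K = K1 + 2 * K2 + 4 * K3"
  have "\<bar>X0 x - 5 / 2\<bar> \<le> K * x\<^sup>2 \<and> \<bar>Z x - 2\<bar> \<le> K * x\<^sup>2 \<and> \<bar>W x\<bar> \<le> K * x\<^sup>2"
    if x: "0 < x" "x \<le> 1" for x
  proof -
    have t: "x\<^sup>2 \<in> {0..1}" using x by (auto simp: power_le_one)
    have nn: "K1 * x\<^sup>2 \<ge> 0" "K2 * x\<^sup>2 \<ge> 0" "K3 * x\<^sup>2 \<ge> 0"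
      using K1 K2 K3 by auto
    have a: "\<bar>F (x\<^sup>2) - 5 / 2\<bar> \<le> K1 * x\<^sup>2" "\<bar>F1 (x\<^sup>2) - 1\<bar> \<le> K2 * x\<^sup>2"
      using K1(2) K2(2) t by blast+
    have "\<bar>W x\<bar> = 4 * (\<bar>F2 (x\<^sup>2)\<bar> * x\<^sup>2)"
      using x by (simp add: W_eq abs_mult)
    also have "\<dots> \<le> 4 * (K3 * x\<^sup>2)"
      using K3(2)[OF t] by (intro mult_left_mono mult_right_mono) auto
    finally have "\<bar>W x\<bar> \<le> 4 * (K3 * x\<^sup>2)" .
    moreover have "K * x\<^sup>2 = K1 * x\<^sup>2 + 2 * (K2 * x\<^sup>2) + 4 * (K3 * x\<^sup>2)"
      by (simp add: K_def algebra_simps)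
    ultimately show ?thesis
      using a nn x by (simp add: X0_eq Z_eq)
  qed
  moreover have "K > 0" using K1 K2 K3 by (simp add: K_def)
  ultimately show ?thesis by blast
qed

section \<open>Expansion of the frame coefficients at \<open>x = 0\<close>, uniformly in
  \<open>y\<close>\<close>

section \<open>Coefficients near x = 0\<close>

definition p :: "real \<Rightarrow> real" where "p y = sqrt (1 + y\<^sup>2)"

text \<open>In terms of \<open>w = (Xb + y \<phi>) / p\<close> one has \<open>x Xa\<^sub>x = k1 w + l1 \<xi>\<close> and
  \<open>v1 = al w + be \<xi> + ga Xa\<close>; at \<open>x = 0\<close> the coefficients \<open>(al, be, ga)\<close> become \<open>(al0, be0, 0)\<close>
  and \<open>(k1, l1)\<close> become \<open>\<surd>5/2\<close> times \<open>(be0, - al0)\<close>.\<close>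

definition k1 :: "real \<Rightarrow> real \<Rightarrow> real" where
  "k1 x y = 2 * p y * (X0 x + sqrt 5 / 2) / h x y"

definition l1 :: "real \<Rightarrow> real \<Rightarrow> real" where
  "l1 x y = (X0 x + sqrt 5 / 2 + sqrt 5 * (x\<^sup>2 - y\<^sup>2)) / h x y"

definition al :: "real \<Rightarrow> real \<Rightarrow> real" where
  "al x y = - 1 + 2 * (1 + y\<^sup>2) * Z x / h x y"

definition be :: "real \<Rightarrow> real \<Rightarrow> real" where
  "be x y = p y * (Z x + 2 * sqrt 5) / h x y"

definition ga :: "real \<Rightarrow> real \<Rightarrow> real" where
  "ga x y = - (2 * p y * W x / h x y)"

definition al0 :: "real \<Rightarrow> real" where
  "al0 y = (2 * y\<^sup>2 - 1 - sqrt 5) / h0 y"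

definition be0 :: "real \<Rightarrow> real" where
  "be0 y = 2 * (1 + sqrt 5) * p y / h0 y"

lemma p_pos: "p y > 0" and p_sq: "(p y)\<^sup>2 = 1 + y\<^sup>2" and p_ge_1: "1 \<le> p y"
  and p_le: "p y \<le> 1 + y\<^sup>2" and abs_le_p: "\<bar>y\<bar> \<le> p y"
proof -
  show p: "p y > 0" by (simp add: p_def add_pos_nonneg)
  show sq: "(p y)\<^sup>2 = 1 + y\<^sup>2" by (simp add: p_def add_nonneg_nonneg)
  show "1 \<le> p y" by (simp add: p_def)
  then have "p y * 1 \<le> p y * p y" using p by (intro mult_left_mono) auto
  then show "p y \<le> 1 + y\<^sup>2" using sq by (simp add: power2_eq_square)
  show "\<bar>y\<bar> \<le> p y" by (simp add: p_def real_le_rsqrt)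
qed

lemma h0_ge: "h0 y \<ge> 1 + y\<^sup>2"
  by (simp add: h0_def add_nonneg_nonneg add_increasing2)

lemma h0_pos: "h0 y > 0"
  using h0_ge[of y] zero_le_power2[of y] by linarith

lemma sqrt5_mult [simp]: "sqrt 5 * sqrt 5 = 5" "sqrt 5 * (sqrt 5 * z) = 5 * z"
  by (simp_all add: mult.assoc[symmetric])

text \<open>This makes the vectors \<open>V0\<close> and \<open>Q\<close> defined later an
  orthonormal basis of the plane of \<open>w\<close> and \<open>\<xi>\<close>.\<close>

lemma al0_be0_sq: "(al0 y)\<^sup>2 + (be0 y)\<^sup>2 = 1"
proof -
  have "(2 * y\<^sup>2 - 1 - sqrt 5)\<^sup>2 + (2 * (1 + sqrt 5))\<^sup>2 * (1 + y\<^sup>2) = (h0 y)\<^sup>2"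
    by (simp add: h0_def power2_eq_square algebra_simps)
  then have "(2 * y\<^sup>2 - 1 - sqrt 5)\<^sup>2 + (2 * (1 + sqrt 5) * p y)\<^sup>2 = (h0 y)\<^sup>2"
    by (simp add: power_mult_distrib p_sq)
  then show ?thesis
    using h0_pos[of y] by (simp add: al0_def be0_def power_divide add_divide_distrib[symmetric])
qed

lemma abs_al0_le: "\<bar>al0 y\<bar> \<le> 1" and abs_be0_le: "\<bar>be0 y\<bar> \<le> 1"
  using al0_be0_sq[of y] zero_le_power2[of "al0 y"] zero_le_power2[of "be0 y"]
  by (simp_all only: abs_square_le_1[symmetric])

text \<open>After clearing the denominator, the two sides differ by \<open>1 + y^2\<close> times the
  first integral, which is zero. This is why \<open>v1\<close> is a unit vector.\<close>

lemma al_be_ga_sq: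
  assumes "x \<noteq> 0" "h x y \<noteq> 0"
  shows "(al x y)\<^sup>2 + (be x y)\<^sup>2 + (ga x y)\<^sup>2 = 1"
proof -
  let ?q = "1 + y\<^sup>2" and ?h = "h x y"
  have "al x y = (2 * ?q * Z x - ?h) / ?h"
    using assms by (simp add: al_def diff_divide_distrib)
  then have "(al x y)\<^sup>2 + (be x y)\<^sup>2 + (ga x y)\<^sup>2
      = ((2 * ?q * Z x - ?h)\<^sup>2 + ?q * (Z x + 2 * sqrt 5)\<^sup>2 + 4 * ?q * (W x)\<^sup>2) / ?h\<^sup>2"
    by (simp add: be_def ga_def power_divide power_mult_distrib p_sq add_divide_distrib)
  also have "(2 * ?q * Z x - ?h)\<^sup>2 + ?q * (Z x + 2 * sqrt 5)\<^sup>2 + 4 * ?q * (W x)\<^sup>2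
     = ?h\<^sup>2 + ?q * (4 * ?q * (Z x)\<^sup>2 - 4 * Z x * ?h + (Z x + 2 * sqrt 5)\<^sup>2 + 4 * (W x)\<^sup>2)"
    by (simp add: power2_eq_square algebra_simps)
  also have "4 * ?q * (Z x)\<^sup>2 - 4 * Z x * ?h + (Z x + 2 * sqrt 5)\<^sup>2 + 4 * (W x)\<^sup>2
     = 5 * (Z x)\<^sup>2 - 8 * X0 x * Z x + 4 * x\<^sup>2 * (Z x)\<^sup>2 + 4 * (W x)\<^sup>2 + 20"
    unfolding h_eq[OF assms(1)] by (simp add: power2_eq_square algebra_simps)
  finally show ?thesis
    using assms first_integral[OF assms(1)] by simp
qed

text \<open>All quantities are measured against a common weight \<open>q\<close>, later
  \<open>1 + y^2\<close>, which cancels in the quotients. The resulting error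
  \<open>(1 + C) * e\<close> is therefore free of \<open>y\<close>.\<close>

lemma quotient_diff_bound:
  fixes r r0 d d0 q e C :: real
  assumes "0 < q" "q \<le> d" "q \<le> d0" "\<bar>r - r0\<bar> \<le> e * q" "\<bar>d - d0\<bar> \<le> e * q" "\<bar>r0\<bar> \<le> C * q"
  shows "\<bar>r / d - r0 / d0\<bar> \<le> (1 + C) * e"
proof -
  have pos: "d > 0" "d0 > 0" using assms by auto
  have e: "e \<ge> 0" using assms(1,4) by (metis abs_ge_zero order_trans zero_le_mult_iff not_less)
  have C: "C \<ge> 0" using assms(1,6) by (metis abs_ge_zero order_trans zero_le_mult_iff not_less)
  have "r / d - r0 / d0 = (r - r0) / d - (r0 / d0) * ((d - d0) / d)"
    using pos by (simp add: field_simps)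
  then have "\<bar>r / d - r0 / d0\<bar> \<le> \<bar>r - r0\<bar> / d + (\<bar>r0\<bar> / d0) * (\<bar>d - d0\<bar> / d)"
    using pos abs_triangle_ineq4[of "(r - r0) / d" "(r0 / d0) * ((d - d0) / d)"]
    by (simp add: abs_mult abs_divide)
  also have "\<dots> \<le> e + C * e"
  proof (intro add_mono mult_mono)
    show "\<bar>r - r0\<bar> / d \<le> e" "\<bar>d - d0\<bar> / d \<le> e" "\<bar>r0\<bar> / d0 \<le> C"
      using assms pos e C mult_left_mono[of q d e] mult_left_mono[of q d0 C]
      by (auto simp: pos_divide_le_eq)
  qed (use pos C in auto)
  finally show ?thesis by (simp add: algebra_simps)
qed

text \<open>Each coefficient is a quotient by \<open>h\<close>, up to an additive constant.
  Numerator and denominator change by at most a multiple of \<open>x^2 * (1 + y^2)\<close> from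
  \<open>x = 0\<close>, and both denominators are at least \<open>1 + y^2\<close>.\<close>

lemma coefficient_estimates:
  obtains \<delta> K where "0 < \<delta>" "\<delta> \<le> 1" "0 \<le> K"
    "\<forall>x y. 0 < x \<and> x < \<delta> \<longrightarrow>
     1 + y\<^sup>2 \<le> h x y \<and>
     \<bar>k1 x y - sqrt 5 / 2 * be0 y\<bar> \<le> K * x\<^sup>2 \<and> \<bar>l1 x y + sqrt 5 / 2 * al0 y\<bar> \<le> K * x\<^sup>2 \<and>
     \<bar>al x y - al0 y\<bar> \<le> K * x\<^sup>2 \<and> \<bar>be x y - be0 y\<bar> \<le> K * x\<^sup>2 \<and> \<bar>ga x y\<bar> \<le> K * x\<^sup>2"
proof -
  obtain K where K: "K > 0" and exp:
    "\<And>x. 0 < x \<Longrightarrow> x \<le> 1 \<Longrightarrow> \<bar>X0 x - 5 / 2\<bar> \<le> K * x\<^sup>2"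
    "\<And>x. 0 < x \<Longrightarrow> x \<le> 1 \<Longrightarrow> \<bar>Z x - 2\<bar> \<le> K * x\<^sup>2"
    "\<And>x. 0 < x \<Longrightarrow> x \<le> 1 \<Longrightarrow> \<bar>W x\<bar> \<le> K * x\<^sup>2"
    using X0_expansion_near_0 by metis
  \<comment> \<open>The first bound gives \<open>x^2 \<le> 1 / 4\<close>, the second gives
    \<open>K * x^2 \<le> 1 / 2\<close>. Then \<open>Z x\<close> lies between 1 and 3 and the lower
    bound for \<open>h\<close> follows.\<close>
  define \<delta> where "\<delta> = min (1 / 2) (1 / (2 * K))"
  \<comment> \<open>\<open>h\<close> contributes \<open>2 * K\<close> from \<open>2 * X0\<close> and
    3 from \<open>x^2 * Z x \<le> 3 * x^2\<close>; the part \<open>y^2 * (Z x - 2)\<close> is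
    covered by the weight \<open>q\<close>.\<close>
  define L where "L = 2 * K + 3"
  have s5: "2 \<le> sqrt 5" "sqrt 5 \<le> 3" by (auto intro: real_le_rsqrt real_le_lsqrt)
  have "1 + y\<^sup>2 \<le> h x y \<and>
     \<bar>k1 x y - sqrt 5 / 2 * be0 y\<bar> \<le> 9 * L * x\<^sup>2 \<and> \<bar>l1 x y + sqrt 5 / 2 * al0 y\<bar> \<le> 9 * L * x\<^sup>2 \<and>
     \<bar>al x y - al0 y\<bar> \<le> 9 * L * x\<^sup>2 \<and> \<bar>be x y - be0 y\<bar> \<le> 9 * L * x\<^sup>2 \<and> \<bar>ga x y\<bar> \<le> 9 * L * x\<^sup>2"
    if x: "0 < x" "x < \<delta>" for x y
  proof -
    define q where "q = 1 + y\<^sup>2"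
    have q1: "q \<ge> 1" and y2: "y\<^sup>2 = q - 1" by (simp_all add: q_def)
    have x1: "x < 1 / 2" "x < 1 / (2 * K)" using x by (auto simp: \<delta>_def)
    have x2: "x\<^sup>2 \<le> 1 / 4"
      using power_mono[of x "1 / 2" 2] x x1 by (simp add: power2_eq_square)
    have "x\<^sup>2 \<le> x * 1" using x x1 unfolding power2_eq_square by (intro mult_left_mono) auto
    then have "K * x\<^sup>2 \<le> K * (1 / (2 * K))" using K x1 by (intro mult_left_mono) auto
    then have Kx: "K * x\<^sup>2 \<le> 1 / 2" using K by simp
    define e where "e = K * x\<^sup>2"
    have X: "\<bar>X0 x - 5 / 2\<bar> \<le> e" and Z: "\<bar>Z x - 2\<bar> \<le> e" and W: "\<bar>W x\<bar> \<le> e"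
      using exp[of x] x x1 by (auto simp: e_def)
    have e: "0 \<le> e" "e \<le> 1 / 2" using K Kx by (auto simp: e_def)
    have Lx: "L * x\<^sup>2 = 2 * e + 3 * x\<^sup>2" by (simp add: L_def e_def algebra_simps)
    have bds: "\<bar>2 * X0 x - 5\<bar> \<le> L * x\<^sup>2" "\<bar>Z x - 2\<bar> \<le> L * x\<^sup>2"
      "\<bar>2 * Z x - 4\<bar> \<le> L * x\<^sup>2" "\<bar>2 * W x\<bar> \<le> L * x\<^sup>2"
      using X Z W Lx e zero_le_power2[of x] by linarith+
    have lift: "t \<le> L * x\<^sup>2 * q" if "t \<le> L * x\<^sup>2" for t
      using that mult_left_mono[OF q1, of "L * x\<^sup>2"] Lx e by simp
    have h: "h x y = 2 * X0 x + sqrt 5 - x\<^sup>2 * Z x + y\<^sup>2 * Z x"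
      using x by (intro h_eq) auto
    have xZ: "0 \<le> x\<^sup>2 * Z x" "x\<^sup>2 * Z x \<le> x\<^sup>2 * 3" "y\<^sup>2 * 1 \<le> y\<^sup>2 * Z x"
      using Z e by (intro mult_nonneg_nonneg mult_left_mono; simp)+
    have hge: "q \<le> h x y"
      using h xZ X e s5 x2 y2 by linarith
    have "\<bar>y\<^sup>2 * (Z x - 2)\<bar> \<le> y\<^sup>2 * e"
      using Z by (simp add: abs_mult mult_left_mono)
    moreover have "h x y - h0 y = (X0 x - 5 / 2) + (X0 x - 5 / 2) - x\<^sup>2 * Z x + y\<^sup>2 * (Z x - 2)"
      by (simp add: h h0_def algebra_simps)
    ultimately have "\<bar>h x y - h0 y\<bar> \<le> 2 * e + 3 * x\<^sup>2 + y\<^sup>2 * e"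
      using X xZ by linarith
    also have "\<dots> \<le> L * x\<^sup>2 * q"
    proof -
      have "L * x\<^sup>2 * q = L * x\<^sup>2 + y\<^sup>2 * (L * x\<^sup>2)" by (simp add: q_def algebra_simps)
      moreover have "y\<^sup>2 * e \<le> y\<^sup>2 * (L * x\<^sup>2)" using Lx e by (intro mult_left_mono) auto
      ultimately show ?thesis using Lx by linarith
    qed
    finally have hd: "\<bar>h x y - h0 y\<bar> \<le> L * x\<^sup>2 * q" .
    \<comment> \<open>The constant 8 serves for all five numerators at \<open>x = 0\<close>, because
      \<open>sqrt 5 \<le> 3\<close> and \<open>p y \<le> q\<close>. This is the origin of the factor
      \<open>9 = 1 + 8\<close>.\<close>
    note bound = quotient_diff_bound[of q "h x y" "h0 y" _ _ "L * x\<^sup>2" 8, OF _ hge _ _ hd]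
    have h0q: "q \<le> h0 y" using h0_ge by (simp add: q_def)
    have q0: "0 < q" using q1 by simp
    have scaled: "\<bar>p y * t\<bar> \<le> L * x\<^sup>2 * q" if "\<bar>t\<bar> \<le> L * x\<^sup>2" for t
    proof -
      have "\<bar>p y * t\<bar> = \<bar>t\<bar> * p y" using p_pos[of y] by (simp add: abs_mult)
      also have "\<dots> \<le> L * x\<^sup>2 * q"
        using that p_le[of y] p_pos[of y] by (intro mult_mono) (auto simp: q_def)
      finally show ?thesis .
    qed
    have p8: "\<bar>p y * t\<bar> \<le> 8 * q" if "0 \<le> t" "t \<le> 8" for t
      using mult_mono[of "p y" q t 8] that p_le[of y] p_pos[of y] q0
      by (simp add: q_def[symmetric] abs_mult mult.commute)
    have 1: "\<bar>(p y * (2 * X0 x + sqrt 5)) / h x y - (p y * (5 + sqrt 5)) / h0 y\<bar> \<le> (1 + 8) * (L * x\<^sup>2)"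
    proof (rule bound[OF q0 h0q])
      have "\<bar>p y * (2 * X0 x - 5)\<bar> \<le> L * x\<^sup>2 * q" by (intro scaled bds)
      then show "\<bar>p y * (2 * X0 x + sqrt 5) - p y * (5 + sqrt 5)\<bar> \<le> L * x\<^sup>2 * q"
        by (simp add: algebra_simps)
      show "\<bar>p y * (5 + sqrt 5)\<bar> \<le> 8 * q" using s5 by (intro p8) auto
    qed
    have 2: "\<bar>(X0 x + sqrt 5 / 2 + sqrt 5 * (x\<^sup>2 - y\<^sup>2)) / h x y
        - ((5 + sqrt 5) / 2 - sqrt 5 * y\<^sup>2) / h0 y\<bar> \<le> (1 + 8) * (L * x\<^sup>2)"
    proof (rule bound[OF q0 h0q])
      have "0 \<le> sqrt 5 * x\<^sup>2" "sqrt 5 * x\<^sup>2 \<le> 3 * x\<^sup>2" using s5 by (auto intro: mult_right_mono)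
      then have "\<bar>(X0 x - 5 / 2) + sqrt 5 * x\<^sup>2\<bar> \<le> L * x\<^sup>2" using X Lx e by linarith
      moreover have "X0 x + sqrt 5 / 2 + sqrt 5 * (x\<^sup>2 - y\<^sup>2) - ((5 + sqrt 5) / 2 - sqrt 5 * y\<^sup>2)
          = (X0 x - 5 / 2) + sqrt 5 * x\<^sup>2" by (simp add: algebra_simps add_divide_distrib)
      ultimately show "\<bar>X0 x + sqrt 5 / 2 + sqrt 5 * (x\<^sup>2 - y\<^sup>2) - ((5 + sqrt 5) / 2 - sqrt 5 * y\<^sup>2)\<bar>
          \<le> L * x\<^sup>2 * q" using lift by simp
      have "0 \<le> sqrt 5 * y\<^sup>2" "sqrt 5 * y\<^sup>2 \<le> 3 * y\<^sup>2" using s5 by (auto intro: mult_right_mono)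
      moreover have "(5 + sqrt 5) / 2 = 5 / 2 + sqrt 5 / 2" by (simp add: add_divide_distrib)
      ultimately show "\<bar>(5 + sqrt 5) / 2 - sqrt 5 * y\<^sup>2\<bar> \<le> 8 * q" using s5 y2 q1 by linarith
    qed
    have 3: "\<bar>(2 * (1 + y\<^sup>2) * Z x) / h x y - (4 * (1 + y\<^sup>2)) / h0 y\<bar> \<le> (1 + 8) * (L * x\<^sup>2)"
    proof (rule bound[OF q0 h0q])
      have "\<bar>2 * Z x - 4\<bar> * q \<le> L * x\<^sup>2 * q" using bds q0 by (intro mult_right_mono) auto
      then have "\<bar>(2 * Z x - 4) * q\<bar> \<le> L * x\<^sup>2 * q" using q0 by (simp add: abs_mult)
      then show "\<bar>2 * (1 + y\<^sup>2) * Z x - 4 * (1 + y\<^sup>2)\<bar> \<le> L * x\<^sup>2 * q"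
        by (simp add: q_def algebra_simps)
      show "\<bar>4 * (1 + y\<^sup>2)\<bar> \<le> 8 * q" using q0 by (simp add: q_def)
    qed
    have 4: "\<bar>(p y * (Z x + 2 * sqrt 5)) / h x y - (p y * (2 + 2 * sqrt 5)) / h0 y\<bar>
        \<le> (1 + 8) * (L * x\<^sup>2)"
    proof (rule bound[OF q0 h0q])
      have "\<bar>p y * (Z x - 2)\<bar> \<le> L * x\<^sup>2 * q" by (intro scaled bds)
      then show "\<bar>p y * (Z x + 2 * sqrt 5) - p y * (2 + 2 * sqrt 5)\<bar> \<le> L * x\<^sup>2 * q"
        by (simp add: algebra_simps)
      show "\<bar>p y * (2 + 2 * sqrt 5)\<bar> \<le> 8 * q" using s5 by (intro p8) auto
    qed
    have 5: "\<bar>(p y * (2 * W x)) / h x y - 0 / h0 y\<bar> \<le> (1 + 8) * (L * x\<^sup>2)"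
    proof (rule bound[OF q0 h0q])
      have "\<bar>p y * (2 * W x)\<bar> \<le> L * x\<^sup>2 * q" by (intro scaled bds)
      then show "\<bar>p y * (2 * W x) - 0\<bar> \<le> L * x\<^sup>2 * q" by simp
    qed (use q0 in auto)
    have "k1 x y = (p y * (2 * X0 x + sqrt 5)) / h x y"
      by (simp add: k1_def algebra_simps)
    moreover have "sqrt 5 / 2 * be0 y = (p y * (5 + sqrt 5)) / h0 y"
      by (simp add: be0_def algebra_simps)
    moreover have "- (sqrt 5 / 2 * al0 y) = ((5 + sqrt 5) / 2 - sqrt 5 * y\<^sup>2) / h0 y"
    proof -
      have eq: "- (sqrt 5 / 2 * (2 * y\<^sup>2 - 1 - sqrt 5)) = (5 + sqrt 5) / 2 - sqrt 5 * y\<^sup>2"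
        by (simp add: field_simps)
      show ?thesis unfolding eq[symmetric] al0_def by simp
    qed
    \<comment> \<open>In this form the summand \<open>- 1\<close> cancels against the one in
      \<open>al\<close>, and only the quotient estimate remains.\<close>
    moreover have "al0 y = - 1 + (4 * (1 + y\<^sup>2)) / h0 y"
      using h0_pos[of y] by (simp add: al0_def field_simps) (simp add: h0_def)
    moreover have "be0 y = (p y * (2 + 2 * sqrt 5)) / h0 y"
      by (simp add: be0_def algebra_simps)
    moreover have "ga x y = - ((p y * (2 * W x)) / h x y)"
      by (simp add: ga_def algebra_simps)
    ultimately show ?thesis
      using 1 2 3 4 5 hge unfolding l1_def al_def be_def by (simp add: q_def)
  qed
  moreover have "0 < \<delta>" "\<delta> \<le> 1" "0 \<le> 9 * L" using K by (auto simp: \<delta>_def L_def)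
  ultimately show ?thesis using that[of \<delta> "9 * L"] by blast
qed

section \<open>Limits at x = 0 and circles\<close>

text \<open>A bounded derivative makes \<open>M\<close> Lipschitz in \<open>x\<close>, so it is
  Cauchy as \<open>x\<close> tends to 0. Letting the second point tend to 0 in the Lipschitz bound
  gives the rate, with the same \<open>K\<close> for every \<open>y\<close>.\<close>

lemma uniform_limit_at_0:
  fixes M :: "real \<Rightarrow> real \<Rightarrow> 'a::banach"
  assumes "\<delta> > 0"
    and deriv: "\<And>x y. 0 < x \<Longrightarrow> x < \<delta> \<Longrightarrow> ((\<lambda>s. M s y) has_vector_derivative M' x y) (at x)"
    and bound: "\<And>x y. 0 < x \<Longrightarrow> x < \<delta> \<Longrightarrow> norm (M' x y) \<le> K"
  shows "\<exists>L. \<forall>x y. 0 < x \<and> x < \<delta> \<longrightarrow> norm (M x y - L y) \<le> K * x"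
proof -
  have K: "K \<ge> 0" using order_trans[OF norm_ge_zero bound[of "\<delta> / 2" 0]] assms(1) by simp
  have lip: "norm (M s y - M t y) \<le> K * \<bar>s - t\<bar>" if "s \<in> {0<..<\<delta>}" "t \<in> {0<..<\<delta>}" for s t y
  proof -
    have "norm (M s y - M t y) \<le> K * norm (s - t)"
    proof (rule differentiable_bound[where f = "\<lambda>s. M s y" and f' = "\<lambda>r d. d *\<^sub>R M' r y"
        and S = "{0<..<\<delta>}"])
      show "((\<lambda>s. M s y) has_derivative (\<lambda>d. d *\<^sub>R M' r y)) (at r within {0<..<\<delta>})"
        if "r \<in> {0<..<\<delta>}" for r
        using deriv[of r y] that by (auto simp: has_vector_derivative_def intro: has_derivative_at_withinI)
      show "onorm (\<lambda>d. d *\<^sub>R M' r y) \<le> K" if "r \<in> {0<..<\<delta>}" for r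
      proof (rule onorm_bound[OF K])
        show "norm (d *\<^sub>R M' r y) \<le> K * norm d" for d
          using bound[of r y] that mult_left_mono[of "norm (M' r y)" K "\<bar>d\<bar>"]
          by (simp add: mult.commute)
      qed
    qed (use that in auto)
    then show ?thesis by simp
  qed
  \<comment> \<open>The offset 2 keeps even the first term, \<open>\<delta> / 2\<close>, strictly
    inside the interval.\<close>
  define s where "s n = \<delta> / (real n + 2)" for n
  have s: "s n \<in> {0<..<\<delta>}" for n using assms(1) by (simp add: s_def field_simps add_pos_nonneg)
  have s0: "s \<longlonglongrightarrow> 0" unfolding s_def using assms(1) by real_asymp
  have "\<exists>l. (\<lambda>n. M (s n) y) \<longlonglongrightarrow> l" for y
  proof -
    have "K-lipschitz_on {0<..<\<delta>} (\<lambda>s. M s y)"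
      using K lip by (intro lipschitz_onI) (simp_all add: dist_norm)
    then have "uniformly_continuous_on {0<..<\<delta>} (\<lambda>s. M s y)"
      by (rule lipschitz_on_uniformly_continuous)
    then have "Cauchy (\<lambda>n. M (s n) y)"
      by (rule uniformly_continuous_on_Cauchy[of _ "\<lambda>s. M s y" s])
        (use s s0 LIMSEQ_imp_Cauchy in blast)+
    then show ?thesis by (simp add: Cauchy_convergent_iff convergent_def)
  qed
  then obtain L where L: "\<And>y. (\<lambda>n. M (s n) y) \<longlonglongrightarrow> L y" by metis
  have "norm (M x y - L y) \<le> K * x" if x: "0 < x" "x < \<delta>" for x y
  proof (rule LIMSEQ_le)
    show "(\<lambda>n. norm (M x y - M (s n) y)) \<longlonglongrightarrow> norm (M x y - L y)"
      by (intro tendsto_intros L)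
    have "(\<lambda>n. K * \<bar>x - s n\<bar>) \<longlonglongrightarrow> K * \<bar>x - 0\<bar>" by (intro tendsto_intros s0)
    then show "(\<lambda>n. K * \<bar>x - s n\<bar>) \<longlonglongrightarrow> K * x" using x by simp
    show "\<exists>N. \<forall>n\<ge>N. norm (M x y - M (s n) y) \<le> K * \<bar>x - s n\<bar>"
      using lip[OF _ s] x by auto
  qed
  then show ?thesis by blast
qed

lemma tendsto_at_right_0_if_linear_bound:
  fixes g :: "real \<Rightarrow> 'a::real_normed_vector"
  assumes "\<delta> > 0" and "\<And>x. 0 < x \<Longrightarrow> x < \<delta> \<Longrightarrow> norm (g x - L) \<le> K * x"
  shows "(g \<longlongrightarrow> L) (at_right 0)"
proof -
  have "((\<lambda>x. K * x) \<longlongrightarrow> K * 0) (at_right 0)" by (intro tendsto_intros)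
  moreover have "\<forall>\<^sub>F x in at_right 0. norm (g x - L) \<le> K * x"
    using eventually_at_right_real[OF assms(1)] by eventually_elim (use assms in auto)
  ultimately show ?thesis
    using Lim_null_comparison[of "\<lambda>x. g x - L" "\<lambda>x. K * x"] by (simp add: LIM_zero_iff)
qed

text \<open>The angle \<open>\<omega> * ln x\<close> takes every value modulo \<open>2 * pi\<close>
  at points arbitrarily close to 0. So the combination vanishes for every angle, in particular for
  \<open>0\<close> and \<open>pi / 2\<close>.\<close>

lemma zero_if_rotation_vanishes_at_0:
  fixes d e :: "'a::real_normed_vector"
  assumes "\<delta> > 0" "\<omega> > 0"
    and bound: "\<And>x. 0 < x \<Longrightarrow> x < \<delta> \<Longrightarrow>
      norm (cos (\<omega> * ln x) *\<^sub>R d + sin (\<omega> * ln x) *\<^sub>R e) \<le> C * x"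
  shows "d = 0" and "e = 0"
proof -
  have zero: "cos \<theta> *\<^sub>R d + sin \<theta> *\<^sub>R e = 0" for \<theta>
  proof -
    \<comment> \<open>\<open>x n\<close> solves
      \<open>\<omega> * ln x = \<theta> - 2 * n * pi\<close>.\<close>
    define x where "x n = exp ((\<theta> - 2 * real n * pi) / \<omega>)" for n :: nat
    have x: "x \<longlonglongrightarrow> 0" unfolding x_def using assms(2) by real_asymp
    have "\<omega> * ln (x n) = \<theta> - 2 * real n * pi" for n using assms(2) by (simp add: x_def)
    then have trig: "cos (\<omega> * ln (x n)) = cos \<theta>" "sin (\<omega> * ln (x n)) = sin \<theta>" for n
      by (simp_all add: cos_diff sin_diff)
    have x_pos: "x n > 0" for n by (simp add: x_def)
    have "norm (cos \<theta> *\<^sub>R d + sin \<theta> *\<^sub>R e) \<le> C * 0"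
    proof (rule tendsto_lowerbound)
      show "(\<lambda>n. C * x n) \<longlonglongrightarrow> C * 0" by (intro tendsto_intros x)
      have "\<forall>\<^sub>F n in sequentially. x n < \<delta>" using x assms(1) by (rule order_tendstoD)
      then show "\<forall>\<^sub>F n in sequentially. norm (cos \<theta> *\<^sub>R d + sin \<theta> *\<^sub>R e) \<le> C * x n"
        by eventually_elim (use bound[OF x_pos] trig in auto)
    qed simp
    then show ?thesis by simp
  qed
  show "d = 0" "e = 0" using zero[of 0] zero[of "pi / 2"] by simp_all
qed

text \<open>The substitution \<open>x = exp (- u)\<close> turns a linear bound at
  \<open>x = 0\<close> into uniform convergence as \<open>u\<close> tends to infinity.\<close>

lemma u_curves_converge_uniformlyI:
  assumes "\<delta> > 0" "C \<ge> 0"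
    and bound: "\<And>x y. 0 < x \<Longrightarrow> x < \<delta> \<Longrightarrow> norm (M x y - N (- ln x) y) \<le> C * x"
  shows "u_curves_converge_uniformly (\<lambda>u y. M (exp (- u)) y) N"
  unfolding u_curves_converge_uniformly_def
proof (intro allI impI)
  fix \<epsilon> :: real assume "\<epsilon> > 0"
  \<comment> \<open>Dividing by \<open>C + 1\<close> covers the case \<open>C = 0\<close> and leaves
    room for the strict inequality.\<close>
  define r where "r = min \<delta> (\<epsilon> / (C + 1))"
  have r: "r > 0" "r \<le> \<delta>" "(C + 1) * r \<le> \<epsilon>"
    using assms(1,2) \<open>\<epsilon> > 0\<close> by (auto simp: r_def)
      (simp add: min_def pos_le_divide_eq mult.commute)
  show "\<exists>U. \<forall>u>U. \<forall>y. norm (M (exp (- u)) y - N u y) < \<epsilon>"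
  proof (intro exI allI impI)
    fix u y assume "u > - ln r"
    then have "exp (- u) < exp (ln r)" by simp
    then have u: "exp (- u) < r" using r by simp
    have "norm (M (exp (- u)) y - N u y) \<le> C * exp (- u)"
      using bound[of "exp (- u)" y] u r by simp
    also have "\<dots> < (C + 1) * r"
    proof -
      have "C * exp (- u) \<le> C * r" using u assms(2) by (intro mult_left_mono) auto
      then show ?thesis using r(1) by (simp add: algebra_simps)
    qed
    finally show "norm (M (exp (- u)) y - N u y) < \<epsilon>" using r by simp
  qed
qed

lemma u_curve_converges_if_uniformly:
  "u_curves_converge_uniformly M N \<Longrightarrow> u_curve_converges M N y"
  unfolding u_curves_converge_uniformly_def u_curve_converges_def by meson

section \<open>Circles with centre and radius depending on a parameter\<close>

lemma norm_v2_vec: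
  assumes "norm b = 1" "norm c = 1" "b \<bullet> c = 0"
  shows "norm (v2_vec b c u) = 1"
proof -
  have "b \<bullet> b = 1" "c \<bullet> c = 1" "c \<bullet> b = 0"
    using assms by (simp_all add: norm_eq_1 inner_commute)
  then show ?thesis
    unfolding norm_eq_1 v2_vec_def using assms
    by (simp add: inner_simps flip: power2_eq_square)
qed

text \<open>As \<open>v2_vec\<close> has norm 1, the distance of the curves at \<open>y\<close> and
  \<open>y0\<close> is at most \<open>norm (P y - P y0) + \<bar>R y - R y0\<bar>\<close>, which does
  not involve \<open>u\<close>.\<close>

lemma deforms_continuously_affine_v2_vec:
  assumes bc: "norm b = 1" "norm c = 1" "b \<bullet> c = 0"
    and P: "continuous_on UNIV P" and R: "continuous_on UNIV R"
  shows "deforms_continuously (\<lambda>u y. P y + R y *\<^sub>R v2_vec b c u)"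
  unfolding deforms_continuously_def
proof
  fix y0
  have P0: "(P \<longlongrightarrow> P y0) (at y0)" and R0: "(R \<longlongrightarrow> R y0) (at y0)"
    using P R by (simp_all add: continuous_on_def)
  have "((\<lambda>y. norm (P y - P y0) + \<bar>R y - R y0\<bar>) \<longlongrightarrow> norm (P y0 - P y0) + \<bar>R y0 - R y0\<bar>) (at y0)"
    by (intro tendsto_intros P0 R0)
  then have lim: "((\<lambda>y. norm (P y - P y0) + \<bar>R y - R y0\<bar>) \<longlongrightarrow> 0) (at y0)" by simp
  show "uniform_limit UNIV (\<lambda>y u. P y + R y *\<^sub>R v2_vec b c u) (\<lambda>u. P y0 + R y0 *\<^sub>R v2_vec b c u) (at y0)"
    unfolding uniform_limit_iff
  proof (intro allI impI)
    fix e :: real assume "e > 0"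
    show "\<forall>\<^sub>F y in at y0. \<forall>u\<in>UNIV. dist (P y + R y *\<^sub>R v2_vec b c u) (P y0 + R y0 *\<^sub>R v2_vec b c u) < e"
      using order_tendstoD(2)[OF lim \<open>e > 0\<close>]
    proof eventually_elim
      case (elim y)
      have "norm ((P y + R y *\<^sub>R v2_vec b c u) - (P y0 + R y0 *\<^sub>R v2_vec b c u))
          \<le> norm (P y - P y0) + \<bar>R y - R y0\<bar>" for u
      proof -
        have eq: "(P y + R y *\<^sub>R v2_vec b c u) - (P y0 + R y0 *\<^sub>R v2_vec b c u)
            = (P y - P y0) + (R y - R y0) *\<^sub>R v2_vec b c u" by (simp add: scaleR_left_diff_distrib)
        show ?thesis
          unfolding eq
          using norm_triangle_ineq[of "P y - P y0" "(R y - R y0) *\<^sub>R v2_vec b c u"]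
          by (simp add: norm_v2_vec[OF bc])
      qed
      then show ?case using elim by (auto simp: dist_norm intro: le_less_trans)
    qed
  qed
qed

lemma range_rescaled:
  fixes g :: "real \<Rightarrow> 'a"
  assumes "k \<noteq> 0"
  shows "range (\<lambda>u. g (k * u)) = range g"
proof -
  have "range (\<lambda>u. k * u) = UNIV"
    using assms by (intro surjI[of _ "\<lambda>t. t / k"]) simp
  then show ?thesis by (metis image_image)
qed

text \<open>The sign of \<open>R\<close> is that of \<open>v3_0\<close> away from
  \<open>y = 0\<close>; the circle has centre \<open>P\<close> and radius
  \<open>- R\<close>.\<close>

lemma is_circle_range_v2_vec:
  assumes bc: "norm b = 1" "norm c = 1" "b \<bullet> c = 0" and "R < 0"
  shows "is_circle (range (\<lambda>u. P + R *\<^sub>R v2_vec b c u))"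
proof -
  have "range (\<lambda>u. P + R *\<^sub>R v2_vec b c u)
      = range (\<lambda>u. (\<lambda>t. P + ((- R) * cos t) *\<^sub>R c + ((- R) * sin t) *\<^sub>R b) (sqrt 5 / 2 * u))"
    by (simp add: v2_vec_def algebra_simps)
  also have "\<dots> = range (\<lambda>t. P + ((- R) * cos t) *\<^sub>R c + ((- R) * sin t) *\<^sub>R b)"
    by (rule range_rescaled) simp
  finally show ?thesis
    unfolding is_circle_def
    by (intro exI[of _ P] exI[of _ c] exI[of _ b] exI[of _ "- R"]) (use assms in \<open>simp add: inner_commute\<close>)
qed

lemma is_circle_range_b_circ:
  assumes bc: "norm b = 1" "norm c = 1" "b \<bullet> c = 0"
  shows "is_circle (range (b_circ b c))"
proof -
  have "range (b_circ b c)
      = range (\<lambda>u. (\<lambda>t. 0 + (1 * cos t) *\<^sub>R b + (1 * sin t) *\<^sub>R (- c)) (sqrt 5 / 2 * u))"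
    by (simp add: b_circ_def[abs_def] algebra_simps)
  also have "\<dots> = range (\<lambda>t. 0 + (1 * cos t) *\<^sub>R b + (1 * sin t) *\<^sub>R (- c))"
    by (rule range_rescaled) simp
  finally show ?thesis
    unfolding is_circle_def
    by (intro exI[of _ 0] exI[of _ b] exI[of _ "- c"] exI[of _ 1]) (use assms in simp)
qed

section \<open>Derivatives of the adapted frame\<close>

lemmas vderiv_linear = has_vector_derivative_add has_vector_derivative_diff has_vector_derivative_minus
  bounded_linear.has_vector_derivative[OF bounded_linear_scaleR_right]

lemma has_vector_derivative_zero_constant_pos:
  fixes g :: "real \<Rightarrow> 'a::real_normed_vector"
  assumes "\<And>s. s > 0 \<Longrightarrow> (g has_vector_derivative 0) (at s)" and "x > 0"
  shows "g x = g 1"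
proof -
  have "\<exists>c. \<forall>s\<in>{0<..}. g s = c"
    using assms(1)
    by (intro has_derivative_zero_constant)
      (auto simp: has_vector_derivative_def intro: has_derivative_at_withinI)
  then show ?thesis using assms(2) by (metis greaterThan_iff zero_less_one)
qed

text \<open>The right side is the component along \<open>V0\<close> of the unit vector
  \<open>(w - 2 p \<xi>) / sqrt (5 + 4 y^2)\<close>, which is \<open>f_vec\<close>. The next lemma
  does the same for the component along \<open>Q\<close>.\<close>

lemma v2_0_eq: "(2 / sqrt 5) * (- v2_0 y) = (al0 y - 2 * p y * be0 y) / sqrt (5 + 4 * y\<^sup>2)"
proof -
  have s: "sqrt (5 + 4 * y\<^sup>2) > 0" by (simp add: add_pos_nonneg)
  have num: "(2 / sqrt 5) * ((5 + 4 * y\<^sup>2) * ((5 + sqrt 5) / 2) - sqrt 5 * y\<^sup>2)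
     = - (2 * y\<^sup>2 - 1 - sqrt 5 - 4 * (1 + sqrt 5) * (p y)\<^sup>2)"
    by (simp add: p_sq field_simps)
  have "(2 / sqrt 5) * (- v2_0 y)
     = - ((2 / sqrt 5) * ((5 + 4 * y\<^sup>2) * ((5 + sqrt 5) / 2) - sqrt 5 * y\<^sup>2)) / (sqrt (5 + 4 * y\<^sup>2) * h0 y)"
    by (simp add: v2_0_def)
  also have "\<dots> = (2 * y\<^sup>2 - 1 - sqrt 5 - 4 * (1 + sqrt 5) * (p y)\<^sup>2) / (sqrt (5 + 4 * y\<^sup>2) * h0 y)"
    unfolding num by simp
  finally show ?thesis
    using s h0_pos[of y] by (simp add: al0_def be0_def power2_eq_square diff_divide_distrib mult_ac)
qed

lemma v3_0_eq: "(2 / sqrt 5) * (- v3_0 y) = (be0 y + 2 * p y * al0 y) / sqrt (5 + 4 * y\<^sup>2)"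
proof -
  have "(2 / sqrt 5) * (- v3_0 y) = 4 * y\<^sup>2 * p y / h0 y / sqrt (5 + 4 * y\<^sup>2)"
    by (simp add: v3_0_def p_def real_sqrt_divide)
  moreover have "be0 y + 2 * p y * al0 y = 4 * y\<^sup>2 * p y / h0 y"
    by (simp add: al0_def be0_def add_divide_distrib[symmetric] algebra_simps)
  ultimately show ?thesis by simp
qed

text \<open>The numerators in the two preceding lemmas are at most \<open>1 + 2 * p y\<close>, hence
  at most \<open>3 * p y\<close>, while \<open>p y\<close> is at most the denominator. Uniformity in
  \<open>y\<close> of the convergence of \<open>f_vec\<close> rests on this.\<close>

lemma abs_v2_0_le: "\<bar>2 / sqrt 5 * v2_0 y\<bar> \<le> 3" and abs_v3_0_le: "\<bar>2 / sqrt 5 * v3_0 y\<bar> \<le> 3"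
proof -
  have s: "p y \<le> sqrt (5 + 4 * y\<^sup>2)" by (simp add: p_def)
  have bound: "\<bar>a + 2 * p y * b\<bar> / sqrt (5 + 4 * y\<^sup>2) \<le> 3" if "\<bar>a\<bar> \<le> 1" "\<bar>b\<bar> \<le> 1" for a b
  proof -
    have "\<bar>2 * p y * b\<bar> \<le> 2 * p y * 1"
      using that p_pos[of y] by (simp add: abs_mult mult_left_le)
    then have "\<bar>a + 2 * p y * b\<bar> \<le> 3 * sqrt (5 + 4 * y\<^sup>2)"
      using that(1) s p_ge_1[of y] by linarith
    then show ?thesis
      using less_le_trans[OF p_pos s] by (simp add: pos_divide_le_eq del: real_sqrt_gt_0_iff)
  qed
  have "\<bar>2 / sqrt 5 * v2_0 y\<bar> = \<bar>2 / sqrt 5 * - v2_0 y\<bar>" "\<bar>2 / sqrt 5 * v3_0 y\<bar> = \<bar>2 / sqrt 5 * - v3_0 y\<bar>"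
    by simp_all
  then show "\<bar>2 / sqrt 5 * v2_0 y\<bar> \<le> 3" "\<bar>2 / sqrt 5 * v3_0 y\<bar> \<le> 3"
    unfolding v2_0_eq v3_0_eq using bound[of "al0 y" "- be0 y"] bound[of "be0 y" "al0 y"] abs_al0_le[of y] abs_be0_le[of y]
    by simp_all
qed

section \<open>The frame adapted to \<open>u_vec\<close> and its derivatives\<close>

locale frame =
  fixes \<phi> Xa Xb \<xi> :: "real \<Rightarrow> real \<Rightarrow> vec4"
  assumes frame: "frame_field \<phi> Xa Xb \<xi>"
begin

lemma frame_orthonormal: "x > 0 \<Longrightarrow> orthonormal4 (\<phi> x y) (Xa x y) (Xb x y) (\<xi> x y)"
  using frame by (auto simp: frame_field_def D_def)

lemma inner_frame:
  assumes "x > 0"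
  shows "\<phi> x y \<bullet> \<phi> x y = 1" "Xa x y \<bullet> Xa x y = 1" "Xb x y \<bullet> Xb x y = 1" "\<xi> x y \<bullet> \<xi> x y = 1"
    "\<phi> x y \<bullet> Xa x y = 0" "\<phi> x y \<bullet> Xb x y = 0" "\<phi> x y \<bullet> \<xi> x y = 0"
    "Xa x y \<bullet> \<phi> x y = 0" "Xa x y \<bullet> Xb x y = 0" "Xa x y \<bullet> \<xi> x y = 0"
    "Xb x y \<bullet> \<phi> x y = 0" "Xb x y \<bullet> Xa x y = 0" "Xb x y \<bullet> \<xi> x y = 0"
    "\<xi> x y \<bullet> \<phi> x y = 0" "\<xi> x y \<bullet> Xa x y = 0" "\<xi> x y \<bullet> Xb x y = 0"
  using frame_orthonormal[OF assms, of y]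
  by (simp_all add: orthonormal4_def norm_eq_1 inner_commute)

lemma frame_dx:
  assumes "x > 0"
  shows "((\<lambda>s. \<phi> s y) has_vector_derivative (- a1 x y *\<^sub>R Xa x y)) (at x)"
    "((\<lambda>s. \<xi> s y) has_vector_derivative (b1 x y *\<^sub>R Xa x y)) (at x)"
    "((\<lambda>s. Xb s y) has_vector_derivative (c1 x y *\<^sub>R Xa x y)) (at x)"
    "((\<lambda>s. Xa s y) has_vector_derivative
       (a1 x y *\<^sub>R \<phi> x y - b1 x y *\<^sub>R \<xi> x y - c1 x y *\<^sub>R Xb x y)) (at x)"
  using frame assms by (auto simp: frame_field_def D_def)

lemma frame_dy:
  assumes "x > 0"
  shows "((\<lambda>t. \<phi> x t) has_vector_derivative (- a2 x y *\<^sub>R Xb x y)) (at y)"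
    "((\<lambda>t. \<xi> x t) has_vector_derivative (b2 x y *\<^sub>R Xb x y)) (at y)"
    "((\<lambda>t. Xa x t) has_vector_derivative (c2 x y *\<^sub>R Xb x y)) (at y)"
    "((\<lambda>t. Xb x t) has_vector_derivative
       (a2 x y *\<^sub>R \<phi> x y - b2 x y *\<^sub>R \<xi> x y - c2 x y *\<^sub>R Xa x y)) (at y)"
  using frame assms by (auto simp: frame_field_def D_def)

definition w :: "real \<Rightarrow> real \<Rightarrow> vec4" where
  "w x y = (1 / p y) *\<^sub>R (Xb x y + y *\<^sub>R \<phi> x y)"

definition Q :: "real \<Rightarrow> real \<Rightarrow> vec4" where
  "Q x y = be0 y *\<^sub>R w x y - al0 y *\<^sub>R \<xi> x y"

text \<open>This is \<open>V1\<close> with the coefficients replaced by their limits at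
  \<open>x = 0\<close>.\<close>

definition V0 :: "real \<Rightarrow> real \<Rightarrow> vec4" where
  "V0 x y = al0 y *\<^sub>R w x y + be0 y *\<^sub>R \<xi> x y"

text \<open>Candidate for \<open>v1\<close>, written at a chosen \<open>x\<close>. Giving it by
  coefficients, and not as a quotient of the derivative of \<open>u_vec\<close> by
  \<open>y^2 / (1 + y^2)\<close>, provides the value at \<open>y = 0\<close>.\<close>

definition V1 :: "real \<Rightarrow> real \<Rightarrow> vec4" where
  "V1 x y = al x y *\<^sub>R w x y + be x y *\<^sub>R \<xi> x y + ga x y *\<^sub>R Xa x y"

lemma inner_w:
  assumes "x > 0"
  shows "w x y \<bullet> w x y = 1" "w x y \<bullet> \<xi> x y = 0" "\<xi> x y \<bullet> w x y = 0"
    "w x y \<bullet> Xa x y = 0" "Xa x y \<bullet> w x y = 0"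
proof -
  have "w x y \<bullet> w x y = (1 + y\<^sup>2) / (p y)\<^sup>2"
    using assms by (simp add: w_def inner_simps inner_frame power2_eq_square add_divide_distrib)
  then show "w x y \<bullet> w x y = 1"
    using p_pos[of y] p_sq[of y] by (metis divide_self less_numeral_extra(3) zero_less_power)
qed (use assms in \<open>simp_all add: w_def inner_simps inner_frame\<close>)

lemma u_vec_orthonormal:
  assumes "x > 0"
  shows "u_vec \<phi> Xb x y \<bullet> u_vec \<phi> Xb x y = 1" "u_vec \<phi> Xb x y \<bullet> w x y = 0"
    "u_vec \<phi> Xb x y \<bullet> \<xi> x y = 0" "u_vec \<phi> Xb x y \<bullet> Xa x y = 0"
proof -
  have u: "u_vec \<phi> Xb x y = (1 / p y) *\<^sub>R (y *\<^sub>R Xb x y - \<phi> x y)"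
    by (simp add: u_vec_def p_def)
  have "u_vec \<phi> Xb x y \<bullet> u_vec \<phi> Xb x y = (1 + y\<^sup>2) / (p y)\<^sup>2"
    using assms by (simp add: u inner_simps inner_frame power2_eq_square add_divide_distrib)
  then show "u_vec \<phi> Xb x y \<bullet> u_vec \<phi> Xb x y = 1"
    using p_pos[of y] p_sq[of y] by (metis divide_self less_numeral_extra(3) zero_less_power)
qed (use assms in \<open>simp_all add: u_vec_def w_def inner_simps inner_frame\<close>)

lemma norm_frame:
  assumes "x > 0"
  shows "norm (w x y) = 1" "norm (\<xi> x y) = 1" "norm (Xa x y) = 1" "norm (Xb x y) = 1" "norm (\<phi> x y) = 1"
  using assms by (simp_all add: norm_eq_1 inner_frame inner_w)

lemma Q_orthonormal:
  assumes "x > 0"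
  shows "Q x y \<bullet> Q x y = 1" "Q x y \<bullet> Xa x y = 0" "Xa x y \<bullet> Q x y = 0" "Q x y \<bullet> V0 x y = 0"
    "u_vec \<phi> Xb x y \<bullet> Q x y = 0"
  using assms al0_be0_sq[of y]
  by (simp_all add: Q_def V0_def inner_simps inner_frame inner_w u_vec_orthonormal power2_eq_square)

lemma V1_orthonormal:
  assumes "x > 0" "h x y \<noteq> 0"
  shows "V1 x y \<bullet> V1 x y = 1" "u_vec \<phi> Xb x y \<bullet> V1 x y = 0"
  using assms al_be_ga_sq[of x y]
  by (simp_all add: V1_def inner_simps inner_frame inner_w u_vec_orthonormal power2_eq_square)

text \<open>Because \<open>a1 = - y * c1\<close>, the vectors \<open>\<phi>\<close> and
  \<open>Xb\<close> enter only through \<open>Xb + y \<phi>\<close>, that is, through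
  \<open>w\<close>.\<close>

lemma Xa_dx:
  assumes "x > 0"
  shows "((\<lambda>s. Xa s y) has_vector_derivative
    ((k1 x y / x) *\<^sub>R w x y + (l1 x y / x) *\<^sub>R \<xi> x y)) (at x)"
proof (rule has_vector_derivative_eq_rhs[OF frame_dx(4)[OF assms]])
  have "a1 x y = k1 x y / x * (y / p y)" "- c1 x y = k1 x y / x * (1 / p y)" "- b1 x y = l1 x y / x"
    using p_pos[of y] by (simp_all add: a1_def b1_def c1_def k1_def l1_def mult_ac)
  then show "a1 x y *\<^sub>R \<phi> x y - b1 x y *\<^sub>R \<xi> x y - c1 x y *\<^sub>R Xb x y
      = (k1 x y / x) *\<^sub>R w x y + (l1 x y / x) *\<^sub>R \<xi> x y"
    by (simp add: w_def scaleR_add_right scaleR_minus_left[symmetric] diff_conv_add_uminus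
        del: scaleR_minus_left add_uminus_conv_diff)
qed

text \<open>The coefficient is the negative of that of \<open>w\<close> in \<open>Xa_dx\<close>, in
  accordance with the skew symmetry of the derivative of an orthonormal frame.\<close>

lemma w_dx:
  assumes "x > 0"
  shows "((\<lambda>s. w s y) has_vector_derivative (- (k1 x y / x) *\<^sub>R Xa x y)) (at x)"
  unfolding w_def
proof (rule has_vector_derivative_eq_rhs)
  show "((\<lambda>s. (1 / p y) *\<^sub>R (Xb s y + y *\<^sub>R \<phi> s y)) has_vector_derivative
      (1 / p y) *\<^sub>R (c1 x y *\<^sub>R Xa x y + y *\<^sub>R (- a1 x y *\<^sub>R Xa x y))) (at x)"
    by (intro vderiv_linear frame_dx assms)
  define m where "m = X0 x + sqrt 5 / 2"
  have forms: "a1 x y = 2 * y * m / (x * h x y)" "c1 x y = - (2 * m / (x * h x y))"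
    "k1 x y = 2 * p y * m / h x y"
    by (simp_all add: a1_def c1_def k1_def m_def)
  have "c1 x y - y * a1 x y = - (2 * m * (1 + y\<^sup>2) / (x * h x y))"
    by (simp add: forms algebra_simps add_divide_distrib power2_eq_square)
  also have "\<dots> = - (2 * m * (p y)\<^sup>2 / (x * h x y))"
    by (simp only: p_sq)
  finally have "(1 / p y) * (c1 x y - y * a1 x y) = - (k1 x y / x)"
    using p_pos[of y] by (simp add: forms(3) power2_eq_square mult_ac)
  then show "(1 / p y) *\<^sub>R (c1 x y *\<^sub>R Xa x y + y *\<^sub>R (- a1 x y *\<^sub>R Xa x y)) = - (k1 x y / x) *\<^sub>R Xa x y"
    by (metis (no_types, opaque_lifting) diff_conv_add_uminus mult_minus_right scaleR_add_left scaleR_scaleR)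
qed

lemma \<xi>_dx:
  assumes "x > 0"
  shows "((\<lambda>s. \<xi> s y) has_vector_derivative (- (l1 x y / x) *\<^sub>R Xa x y)) (at x)"
  by (rule has_vector_derivative_eq_rhs[OF frame_dx(2)[OF assms]]) (simp add: b1_def l1_def)

lemma Q_dx:
  assumes "x > 0"
  shows "((\<lambda>s. Q s y) has_vector_derivative (((al0 y * l1 x y - be0 y * k1 x y) / x) *\<^sub>R Xa x y)) (at x)"
  unfolding Q_def
proof (rule has_vector_derivative_eq_rhs)
  show "((\<lambda>s. be0 y *\<^sub>R w s y - al0 y *\<^sub>R \<xi> s y) has_vector_derivative
      be0 y *\<^sub>R (- (k1 x y / x) *\<^sub>R Xa x y) - al0 y *\<^sub>R (- (l1 x y / x) *\<^sub>R Xa x y)) (at x)"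
    by (intro vderiv_linear w_dx \<xi>_dx assms)
  show "be0 y *\<^sub>R (- (k1 x y / x) *\<^sub>R Xa x y) - al0 y *\<^sub>R (- (l1 x y / x) *\<^sub>R Xa x y)
      = ((al0 y * l1 x y - be0 y * k1 x y) / x) *\<^sub>R Xa x y"
    by (simp add: scaleR_diff_left diff_divide_distrib)
qed

text \<open>The relation \<open>a1 = - y * c1\<close> makes the two \<open>Xa\<close> contributions
  cancel.\<close>

lemma u_vec_dx:
  assumes "x > 0"
  shows "((\<lambda>s. u_vec \<phi> Xb s y) has_vector_derivative 0) (at x)"
  unfolding u_vec_def
proof (rule has_vector_derivative_eq_rhs)
  show "((\<lambda>s. (1 / sqrt (1 + y\<^sup>2)) *\<^sub>R (y *\<^sub>R Xb s y - \<phi> s y)) has_vector_derivative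
      (1 / sqrt (1 + y\<^sup>2)) *\<^sub>R (y *\<^sub>R (c1 x y *\<^sub>R Xa x y) - (- a1 x y *\<^sub>R Xa x y))) (at x)"
    by (intro vderiv_linear frame_dx assms)
  have "y * c1 x y + a1 x y = 0" by (simp add: a1_def c1_def)
  then have "y *\<^sub>R (c1 x y *\<^sub>R Xa x y) - (- a1 x y *\<^sub>R Xa x y) = 0"
    by (simp add: scaleR_add_left[symmetric])
  then show "(1 / sqrt (1 + y\<^sup>2)) *\<^sub>R (y *\<^sub>R (c1 x y *\<^sub>R Xa x y) - (- a1 x y *\<^sub>R Xa x y)) = 0"
    by simp
qed

lemma u_vec_const: "x > 0 \<Longrightarrow> u_vec \<phi> Xb x y = u_vec \<phi> Xb 1 y"
  by (rule has_vector_derivative_zero_constant_pos[of "\<lambda>s. u_vec \<phi> Xb s y"]) (rule u_vec_dx)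

text \<open>A factor \<open>y^2\<close> splits off every term: \<open>1 + a2\<close> equals
  \<open>2 * y^2 * Z / h\<close>, while \<open>b2\<close> and \<open>c2\<close> carry a factor
  \<open>y\<close> and are multiplied by another.\<close>

lemma u_vec_dy:
  assumes x: "x > 0" and h: "h x y \<noteq> 0"
  shows "((\<lambda>t. u_vec \<phi> Xb x t) has_vector_derivative ((y\<^sup>2 / (1 + y\<^sup>2)) *\<^sub>R V1 x y)) (at y)"
proof -
  let ?p = "p y" and ?B = "Xb x y" and ?A = "Xa x y" and ?f = "\<phi> x y" and ?x = "\<xi> x y"
  define r where "r = Z x / h x y"
  have q: "1 + y\<^sup>2 > 0" using zero_le_power2[of y] by linarith
  have p: "?p > 0" "?p * ?p = 1 + y * y" using p_pos p_sq[of y] by (auto simp: power2_eq_square)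
  have "((\<lambda>t. 1 / sqrt (1 + t\<^sup>2)) has_real_derivative - (y / ?p ^ 3)) (at y)"
    using q by (auto intro!: derivative_eq_intros simp: p_def power2_eq_square power3_eq_cube field_simps)
  moreover have "((\<lambda>t. t *\<^sub>R Xb x t - \<phi> x t) has_vector_derivative
      (y *\<^sub>R (a2 x y *\<^sub>R ?f - b2 x y *\<^sub>R ?x - c2 x y *\<^sub>R ?A) + 1 *\<^sub>R ?B) - (- a2 x y *\<^sub>R ?B)) (at y)"
    by (intro has_vector_derivative_diff has_vector_derivative_scaleR frame_dy x DERIV_ident)
  ultimately have "((\<lambda>t. u_vec \<phi> Xb x t) has_vector_derivative
      (1 / sqrt (1 + y\<^sup>2)) *\<^sub>R ((y *\<^sub>R (a2 x y *\<^sub>R ?f - b2 x y *\<^sub>R ?x - c2 x y *\<^sub>R ?A) + 1 *\<^sub>R ?B) - (- a2 x y *\<^sub>R ?B))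
      + (- (y / ?p ^ 3)) *\<^sub>R (y *\<^sub>R ?B - ?f)) (at y)"
    unfolding u_vec_def by (rule has_vector_derivative_scaleR)
  moreover
  have a2: "a2 x y = - 1 + 2 * y\<^sup>2 * r"
  proof -
    have "2 * X0 x + sqrt 5 - (x\<^sup>2 + y\<^sup>2) * (X0' x / x) = h x y - 2 * y\<^sup>2 * Z x"
      using x by (simp add: h_eq Z_def[symmetric] algebra_simps)
    then show ?thesis using h by (simp add: a2_def r_def diff_divide_distrib)
  qed
  have b2: "b2 x y = - (y / ?p) * be x y"
  proof -
    have "X0' x / (2 * x) + sqrt 5 = (Z x + 2 * sqrt 5) / 2" by (simp add: Z_def add_divide_distrib)
    then show ?thesis using p by (simp add: b2_def be_def)
  qed
  have c2: "c2 x y = - (y / ?p) * ga x y"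
    using p by (simp add: c2_def ga_def W_def)
  have al: "al x y = - 1 + 2 * (?p * ?p) * r"
    by (simp add: al_def r_def p power2_eq_square)
  have y2: "y * y = ?p * ?p - 1" using p by simp
  have coeff: "(1 + a2 x y) / ?p - y / ?p ^ 3 * y = y\<^sup>2 / (1 + y\<^sup>2) * al x y / ?p"
  proof -
    have "(1 + a2 x y) / ?p - y / ?p ^ 3 * y = y * y * (2 * r * (?p * ?p) - 1) / ?p ^ 3"
      using p(1) by (simp add: a2 field_simps power3_eq_cube power2_eq_square)
    also have "\<dots> = y * y * al x y / (?p * ?p * ?p)"
      by (simp add: al power3_eq_cube mult_ac)
    finally show ?thesis using p by (simp add: power2_eq_square)
  qed
  \<comment> \<open>The coefficient of \<open>\<phi>\<close> is \<open>y\<close> times that of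
    \<open>Xb\<close>, so together they form a multiple of \<open>w\<close>.\<close>
  have f_coeff: "y * a2 x y / ?p + y / ?p ^ 3 = y\<^sup>2 / (1 + y\<^sup>2) * al x y / ?p * y"
  proof -
    have "y * a2 x y / ?p + y / ?p ^ 3 = y * ((1 + a2 x y) / ?p - (?p * ?p - 1) / ?p ^ 3)"
      using p(1) by (simp add: field_simps power3_eq_cube)
    also have "\<dots> = y * ((1 + a2 x y) / ?p - y / ?p ^ 3 * y)"
      by (simp add: y2[symmetric])
    also have "\<dots> = y * (y\<^sup>2 / (1 + y\<^sup>2) * al x y / ?p)"
      by (simp only: coeff)
    finally show ?thesis by (simp only: mult_ac)
  qed
  have bc_coeff: "y * b2 x y / ?p = - (y\<^sup>2 / (1 + y\<^sup>2) * be x y)" "y * c2 x y / ?p = - (y\<^sup>2 / (1 + y\<^sup>2) * ga x y)"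
    using p by (simp_all add: b2 c2 power2_eq_square)
  have "(1 / sqrt (1 + y\<^sup>2)) *\<^sub>R ((y *\<^sub>R (a2 x y *\<^sub>R ?f - b2 x y *\<^sub>R ?x - c2 x y *\<^sub>R ?A) + 1 *\<^sub>R ?B) - (- a2 x y *\<^sub>R ?B))
      + (- (y / ?p ^ 3)) *\<^sub>R (y *\<^sub>R ?B - ?f)
    = ((1 + a2 x y) / ?p - y / ?p ^ 3 * y) *\<^sub>R ?B + (y * a2 x y / ?p + y / ?p ^ 3) *\<^sub>R ?f
      + (- (y * b2 x y / ?p)) *\<^sub>R ?x + (- (y * c2 x y / ?p)) *\<^sub>R ?A"
    by (simp add: p_def[symmetric] algebra_simps add_divide_distrib)
  moreover have "(y\<^sup>2 / (1 + y\<^sup>2)) *\<^sub>R V1 x y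
    = (y\<^sup>2 / (1 + y\<^sup>2) * al x y / ?p) *\<^sub>R ?B + (y\<^sup>2 / (1 + y\<^sup>2) * al x y / ?p * y) *\<^sub>R ?f
      + (y\<^sup>2 / (1 + y\<^sup>2) * be x y) *\<^sub>R ?x + (y\<^sup>2 / (1 + y\<^sup>2) * ga x y) *\<^sub>R ?A"
    by (simp add: V1_def w_def scaleR_add_right mult_ac)
  ultimately show ?thesis by (simp only: coeff f_coeff bc_coeff minus_minus)
qed

lemma continuous_frame:
  assumes "x > 0"
  shows "continuous_on UNIV (\<lambda>y. \<phi> x y)" "continuous_on UNIV (\<lambda>y. \<xi> x y)"
    "continuous_on UNIV (\<lambda>y. Xa x y)" "continuous_on UNIV (\<lambda>y. Xb x y)"
  using frame_dy[OF assms] by (meson continuous_at_imp_continuous_on has_vector_derivative_continuous)+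

lemma continuous_p: "continuous_on S p"
  unfolding p_def[abs_def] by (intro continuous_intros)

lemma continuous_V1:
  assumes "x > 0" "\<And>y. h x y \<noteq> 0"
  shows "continuous_on UNIV (V1 x)"
proof -
  have h: "continuous_on UNIV (h x)" unfolding h_def[abs_def] by (intro continuous_intros)
  have "p y \<noteq> 0" for y using p_pos[of y] by simp
  then show ?thesis
    unfolding V1_def[abs_def] w_def al_def be_def ga_def
    by (intro continuous_intros continuous_frame continuous_p h assms) (use assms in auto)
qed

text \<open>The terms containing \<open>X0\<close> cancel in
  \<open>c1 - 2 (1 + y^2) b1 - y a1\<close>, and \<open>scale\<close> normalizes what is left to the
  \<open>x\<close>-derivative of the curvature surface.\<close>

lemma f_vec_dx:
  assumes "x > 0"
  shows "((\<lambda>s. scale y *\<^sub>R f_vec \<phi> Xb \<xi> s y) has_vector_derivative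
    (((x\<^sup>2 - y\<^sup>2) / (x * h x y)) *\<^sub>R Xa x y)) (at x)"
proof (rule has_vector_derivative_eq_rhs)
  let ?d = "sqrt ((1 + y\<^sup>2) * (5 + 4 * y\<^sup>2))"
  show "((\<lambda>s. scale y *\<^sub>R f_vec \<phi> Xb \<xi> s y) has_vector_derivative
      scale y *\<^sub>R (1 / ?d) *\<^sub>R (c1 x y *\<^sub>R Xa x y - (2 * (1 + y\<^sup>2)) *\<^sub>R (b1 x y *\<^sub>R Xa x y)
        + y *\<^sub>R (- a1 x y *\<^sub>R Xa x y))) (at x)"
    unfolding f_vec_def by (intro vderiv_linear frame_dx assms)
  have q: "1 + y\<^sup>2 > 0" "5 + 4 * y\<^sup>2 > 0" by (simp_all add: add_pos_nonneg)
  have sc: "scale y / ?d = 1 / (2 * sqrt 5 * (1 + y\<^sup>2))"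
    using q by (simp add: scale_def real_sqrt_mult real_sqrt_divide)
  have "c1 x y - 2 * (1 + y\<^sup>2) * b1 x y - y * a1 x y = 2 * sqrt 5 * (1 + y\<^sup>2) * ((x\<^sup>2 - y\<^sup>2) / (x * h x y))"
  proof -
    define m i where "m = X0 x + sqrt 5 / 2" and "i = 1 / (x * h x y)"
    have eqs: "c1 x y = - 2 * i * m" "b1 x y = - i * (m + sqrt 5 * (x\<^sup>2 - y\<^sup>2))" "a1 x y = 2 * y * i * m"
      "(x\<^sup>2 - y\<^sup>2) / (x * h x y) = (x\<^sup>2 - y\<^sup>2) * i"
      by (simp_all add: a1_def b1_def c1_def m_def i_def)
    show ?thesis unfolding eqs by (simp add: algebra_simps power2_eq_square)
  qed
  then have "scale y / ?d * (c1 x y - 2 * (1 + y\<^sup>2) * b1 x y - y * a1 x y) = (x\<^sup>2 - y\<^sup>2) / (x * h x y)"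
    using q by (simp add: sc)
  moreover have "scale y *\<^sub>R (1 / ?d) *\<^sub>R (c1 x y *\<^sub>R Xa x y - (2 * (1 + y\<^sup>2)) *\<^sub>R (b1 x y *\<^sub>R Xa x y)
        + y *\<^sub>R (- a1 x y *\<^sub>R Xa x y))
    = (scale y / ?d * (c1 x y - 2 * (1 + y\<^sup>2) * b1 x y - y * a1 x y)) *\<^sub>R Xa x y"
    by (simp only: scaleR_scaleR scaleR_diff_left[symmetric] scaleR_add_left[symmetric]) simp
  ultimately show "scale y *\<^sub>R (1 / ?d) *\<^sub>R (c1 x y *\<^sub>R Xa x y - (2 * (1 + y\<^sup>2)) *\<^sub>R (b1 x y *\<^sub>R Xa x y)
        + y *\<^sub>R (- a1 x y *\<^sub>R Xa x y)) = ((x\<^sup>2 - y\<^sup>2) / (x * h x y)) *\<^sub>R Xa x y"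
    by simp
qed

lemma f_vec_eq: "f_vec \<phi> Xb \<xi> x y = (1 / sqrt (5 + 4 * y\<^sup>2)) *\<^sub>R (w x y - (2 * p y) *\<^sub>R \<xi> x y)"
proof -
  have "f_vec \<phi> Xb \<xi> x y
      = (1 / (p y * sqrt (5 + 4 * y\<^sup>2))) *\<^sub>R (Xb x y - (2 * (p y)\<^sup>2) *\<^sub>R \<xi> x y + y *\<^sub>R \<phi> x y)"
    unfolding f_vec_def p_sq by (simp add: p_def real_sqrt_mult)
  then show ?thesis
    using p_pos[of y] by (simp add: w_def scaleR_add_right scaleR_diff_right power2_eq_square mult_ac)
qed

text \<open>Expansion of \<open>f_vec\<close> in the orthonormal pair \<open>V0\<close>,
  \<open>Q\<close>. The limits of \<open>V0\<close> and \<open>Q\<close>, namely \<open>v1\<close>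
  and minus \<open>v2_vec\<close>, turn it into \<open>a_circ\<close>.\<close>

lemma f_vec_eq_V0_Q:
  "f_vec \<phi> Xb \<xi> x y = (2 / sqrt 5) *\<^sub>R (- v2_0 y *\<^sub>R V0 x y - v3_0 y *\<^sub>R Q x y)"
proof -
  let ?s = "sqrt (5 + 4 * y\<^sup>2)"
  have one: "al0 y * al0 y + be0 y * be0 y = 1" using al0_be0_sq[of y] by (simp add: power2_eq_square)
  have "(al0 y - 2 * p y * be0 y) *\<^sub>R V0 x y + (be0 y + 2 * p y * al0 y) *\<^sub>R Q x y
      = (al0 y * al0 y + be0 y * be0 y) *\<^sub>R (w x y - (2 * p y) *\<^sub>R \<xi> x y)"
    by (simp add: V0_def Q_def algebra_simps)
  then have "w x y - (2 * p y) *\<^sub>R \<xi> x y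
      = (al0 y - 2 * p y * be0 y) *\<^sub>R V0 x y + (be0 y + 2 * p y * al0 y) *\<^sub>R Q x y"
    by (simp add: one)
  then have "f_vec \<phi> Xb \<xi> x y
      = ((al0 y - 2 * p y * be0 y) / ?s) *\<^sub>R V0 x y + ((be0 y + 2 * p y * al0 y) / ?s) *\<^sub>R Q x y"
    by (simp add: f_vec_eq scaleR_add_right)
  then show ?thesis
    unfolding v2_0_eq[symmetric] v3_0_eq[symmetric] by (simp add: scaleR_diff_right)
qed

end

section \<open>Asymptotics of \<open>Xa\<close> and \<open>Q\<close> and the constant pair
  \<open>b\<close>, \<open>c\<close>\<close>

section \<open>The asymptotic circle\<close>

text \<open>The constants of \<open>coefficient_estimates\<close> become parameters, so that all
  later bounds refer to the same \<open>\<delta>\<close> and \<open>K\<close>.\<close>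

locale frame_near_0 = frame +
  fixes \<delta> K :: real
  assumes \<delta>: "0 < \<delta>" "\<delta> \<le> 1" and K: "0 \<le> K"
    and estimates: "\<And>x y. 0 < x \<Longrightarrow> x < \<delta> \<Longrightarrow>
     1 + y\<^sup>2 \<le> h x y \<and>
     \<bar>k1 x y - sqrt 5 / 2 * be0 y\<bar> \<le> K * x\<^sup>2 \<and> \<bar>l1 x y + sqrt 5 / 2 * al0 y\<bar> \<le> K * x\<^sup>2 \<and>
     \<bar>al x y - al0 y\<bar> \<le> K * x\<^sup>2 \<and> \<bar>be x y - be0 y\<bar> \<le> K * x\<^sup>2 \<and> \<bar>ga x y\<bar> \<le> K * x\<^sup>2"
begin

lemma h_pos: "0 < x \<Longrightarrow> x < \<delta> \<Longrightarrow> h x y > 0"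
  using estimates[of x y] zero_le_power2[of y] by linarith

lemma square_le_self: "0 < x \<Longrightarrow> x < \<delta> \<Longrightarrow> x\<^sup>2 \<le> x"
  using \<delta> by (simp add: power2_eq_square mult_left_le_one_le)

lemma norm_V1_minus_V0:
  assumes "0 < x" "x < \<delta>"
  shows "norm (V1 x y - V0 x y) \<le> 3 * K * x"
proof -
  have "V1 x y - V0 x y = (al x y - al0 y) *\<^sub>R w x y + (be x y - be0 y) *\<^sub>R \<xi> x y + ga x y *\<^sub>R Xa x y"
    by (simp add: V1_def V0_def algebra_simps)
  also have "norm \<dots> \<le> norm ((al x y - al0 y) *\<^sub>R w x y) + norm ((be x y - be0 y) *\<^sub>R \<xi> x y)
      + norm (ga x y *\<^sub>R Xa x y)"
    by (intro norm_triangle_mono order_refl)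
  also have "\<dots> = \<bar>al x y - al0 y\<bar> + \<bar>be x y - be0 y\<bar> + \<bar>ga x y\<bar>"
    using assms by (simp add: norm_frame)
  also have "\<dots> \<le> 3 * (K * x\<^sup>2)"
    using estimates[OF assms, of y] by linarith
  also have "\<dots> \<le> 3 * (K * x)"
    using K square_le_self[OF assms] by (intro mult_left_mono) auto
  finally show ?thesis by simp
qed

text \<open>\<open>c2 = - (y / p) * ga\<close> with \<open>\<bar>y\<bar> \<le> p\<close>, so the
  \<open>y\<close>-derivative of \<open>Xa\<close> tends to 0 with \<open>x\<close>. This forces the
  limit vectors to be the same for all \<open>y\<close>.\<close>

lemma norm_Xa_diff:
  assumes "0 < x" "x < \<delta>"
  shows "norm (Xa x y1 - Xa x y2) \<le> K * \<bar>y1 - y2\<bar> * x"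
proof -
  have "\<bar>c2 x y\<bar> \<le> K * x" for y
  proof -
    have "c2 x y = - (y / p y) * ga x y"
      using p_pos[of y] by (simp add: c2_def ga_def W_def)
    then have "\<bar>c2 x y\<bar> = (\<bar>y\<bar> / p y) * \<bar>ga x y\<bar>"
      using p_pos[of y] by (simp add: abs_mult)
    also have "\<dots> \<le> 1 * (K * x\<^sup>2)"
      using abs_le_p[of y] p_pos[of y] estimates[OF assms, of y] by (intro mult_mono) auto
    also have "\<dots> \<le> 1 * (K * x)"
      using K square_le_self[OF assms] by (intro mult_left_mono) auto
    finally show ?thesis by simp
  qed
  then have c2: "norm (c2 x y *\<^sub>R Xb x y) \<le> K * x" for y
    using assms by (simp add: norm_frame)
  have "onorm (\<lambda>d. d *\<^sub>R (c2 x y *\<^sub>R Xb x y)) \<le> K * x" for y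
  proof (rule onorm_bound)
    show "norm (d *\<^sub>R (c2 x y *\<^sub>R Xb x y)) \<le> K * x * norm d" for d
      using mult_left_mono[OF c2[of y], of "norm d"]
      by (simp only: norm_scaleR[of d] real_norm_def mult_ac abs_ge_zero)
  qed (use K assms in simp)
  then have "norm (Xa x y1 - Xa x y2) \<le> K * x * norm (y1 - y2)"
    using frame_dy(3)[OF assms(1)]
    by (intro differentiable_bound[where f = "Xa x" and S = UNIV
          and f' = "\<lambda>y d. d *\<^sub>R (c2 x y *\<^sub>R Xb x y)"])
      (auto simp: has_vector_derivative_def)
  then show ?thesis by (simp add: mult_ac)
qed

text \<open>The phases \<open>0\<close> and \<open>- (pi / 2)\<close> give the two vectors of the
  rotated-back pair. The parameter \<open>\<theta>\<close> allows one derivative estimate to serve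
  both.\<close>

definition rot :: "real \<Rightarrow> real \<Rightarrow> real \<Rightarrow> vec4" where
  "rot \<theta> x y = cos (sqrt 5 / 2 * ln x + \<theta>) *\<^sub>R Xa x y - sin (sqrt 5 / 2 * ln x + \<theta>) *\<^sub>R Q x y"

text \<open>To leading order \<open>x Xa\<^sub>x = (\<surd>5/2) Q\<close> and \<open>x Q\<^sub>x = - (\<surd>5/2) Xa\<close>, so that undoing this
  rotation leaves vectors with bounded \<open>x\<close>-derivative.\<close>

lemma rot_dx:
  assumes x: "0 < x" "x < \<delta>"
  shows "\<exists>v. ((\<lambda>s. rot \<theta> s y) has_vector_derivative v) (at x) \<and> norm v \<le> 4 * K"
proof -
  define \<omega> where "\<omega> = sqrt 5 / 2"
  define C S where "C = cos (\<omega> * ln x + \<theta>)" and "S = sin (\<omega> * ln x + \<theta>)"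
  define A' where "A' = (k1 x y / x) *\<^sub>R w x y + (l1 x y / x) *\<^sub>R \<xi> x y"
  define Q' where "Q' = ((al0 y * l1 x y - be0 y * k1 x y) / x) *\<^sub>R Xa x y"
  \<comment> \<open>The derivative regrouped: the terms with \<open>\<omega> / x\<close> come from
    differentiating the angle and cancel the leading parts of \<open>A'\<close> and
    \<open>Q'\<close>.\<close>
  define v where "v = C *\<^sub>R (A' - (\<omega> / x) *\<^sub>R Q x y) - S *\<^sub>R (Q' + (\<omega> / x) *\<^sub>R Xa x y)"
  have cos': "((\<lambda>s. cos (\<omega> * ln s + \<theta>)) has_real_derivative - (S * (\<omega> / x))) (at x)"
    and sin': "((\<lambda>s. sin (\<omega> * ln s + \<theta>)) has_real_derivative C * (\<omega> / x)) (at x)"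
    using x by (auto intro!: derivative_eq_intros simp: C_def S_def)
  have "((\<lambda>s. rot \<theta> s y) has_vector_derivative
      (C *\<^sub>R A' + (- (S * (\<omega> / x))) *\<^sub>R Xa x y) - (S *\<^sub>R Q' + (C * (\<omega> / x)) *\<^sub>R Q x y)) (at x)"
    unfolding rot_def \<omega>_def[symmetric] C_def A'_def Q'_def
    unfolding S_def
    using cos' sin' x unfolding C_def S_def
    by (intro has_vector_derivative_diff has_vector_derivative_scaleR Xa_dx Q_dx)
  then have "((\<lambda>s. rot \<theta> s y) has_vector_derivative v) (at x)"
    by (rule has_vector_derivative_eq_rhs) (simp add: v_def algebra_simps)
  moreover have "norm v \<le> 4 * K"
  proof -
    define A1 A2 where "A1 = k1 x y - \<omega> * be0 y" and "A2 = l1 x y + \<omega> * al0 y"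
    have A: "\<bar>A1\<bar> \<le> K * x\<^sup>2" "\<bar>A2\<bar> \<le> K * x\<^sup>2"
      using estimates[OF x, of y] by (simp_all add: A1_def A2_def \<omega>_def)
    have "A' - (\<omega> / x) *\<^sub>R Q x y = (1 / x) *\<^sub>R (A1 *\<^sub>R w x y + A2 *\<^sub>R \<xi> x y)"
      by (simp add: A'_def Q_def A1_def A2_def algebra_simps diff_divide_distrib add_divide_distrib)
    then have 1: "norm (A' - (\<omega> / x) *\<^sub>R Q x y) \<le> (\<bar>A1\<bar> + \<bar>A2\<bar>) / x"
      using norm_triangle_ineq[of "A1 *\<^sub>R w x y" "A2 *\<^sub>R \<xi> x y"] x
      by (simp add: norm_frame divide_right_mono)
    \<comment> \<open>By \<open>al0_be0_sq\<close>, the leading parts of \<open>l1\<close> and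
      \<open>k1\<close> contribute exactly \<open>- \<omega>\<close>, and only the errors
      \<open>A1\<close> and \<open>A2\<close> survive.\<close>
    have "al0 y * l1 x y - be0 y * k1 x y + \<omega> * 1 = al0 y * A2 - be0 y * A1"
      unfolding al0_be0_sq[of y, symmetric] by (simp add: A1_def A2_def algebra_simps power2_eq_square)
    then have "Q' + (\<omega> / x) *\<^sub>R Xa x y = ((al0 y * A2 - be0 y * A1) / x) *\<^sub>R Xa x y"
      by (simp add: Q'_def scaleR_add_left[symmetric] add_divide_distrib[symmetric])
    then have "norm (Q' + (\<omega> / x) *\<^sub>R Xa x y) = \<bar>al0 y * A2 - be0 y * A1\<bar> / x"
      using x by (simp add: norm_frame)
    also have "\<dots> \<le> (\<bar>A1\<bar> + \<bar>A2\<bar>) / x"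
    proof (rule divide_right_mono)
      have "\<bar>al0 y\<bar> * \<bar>A2\<bar> \<le> 1 * \<bar>A2\<bar>" "\<bar>be0 y\<bar> * \<bar>A1\<bar> \<le> 1 * \<bar>A1\<bar>"
        using abs_al0_le abs_be0_le by (intro mult_right_mono; simp)+
      then show "\<bar>al0 y * A2 - be0 y * A1\<bar> \<le> \<bar>A1\<bar> + \<bar>A2\<bar>"
        using abs_triangle_ineq4[of "al0 y * A2" "be0 y * A1"] by (simp add: abs_mult)
    qed (use x in simp)
    finally have 2: "norm (Q' + (\<omega> / x) *\<^sub>R Xa x y) \<le> (\<bar>A1\<bar> + \<bar>A2\<bar>) / x" .
    have "(\<bar>A1\<bar> + \<bar>A2\<bar>) / x \<le> (2 * (K * x\<^sup>2)) / x"
      using A x by (intro divide_right_mono) auto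
    also have "\<dots> = 2 * K * x" using x by (simp add: power2_eq_square)
    also have "\<dots> \<le> 2 * K * 1" using K x \<delta> by (intro mult_left_mono) auto
    finally have 3: "(\<bar>A1\<bar> + \<bar>A2\<bar>) / x \<le> 2 * K" by simp
    have "norm v \<le> \<bar>C\<bar> * norm (A' - (\<omega> / x) *\<^sub>R Q x y) + \<bar>S\<bar> * norm (Q' + (\<omega> / x) *\<^sub>R Xa x y)"
      unfolding v_def by (rule order_trans[OF norm_triangle_ineq4]) simp
    also have "\<dots> \<le> 1 * (2 * K) + 1 * (2 * K)"
      using 1 2 3 by (intro add_mono mult_mono) (auto simp: C_def S_def)
    finally show ?thesis by simp
  qed
  ultimately show ?thesis by blast
qed

lemma rot_limit: "\<exists>L. \<forall>x y. 0 < x \<and> x < \<delta> \<longrightarrow> norm (rot \<theta> x y - L y) \<le> 4 * K * x"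
proof -
  obtain v where "\<And>x y. 0 < x \<Longrightarrow> x < \<delta> \<Longrightarrow>
      ((\<lambda>s. rot \<theta> s y) has_vector_derivative v x y) (at x) \<and> norm (v x y) \<le> 4 * K"
    using rot_dx[of _ \<theta>] by metis
  then show ?thesis
    by (intro uniform_limit_at_0[of \<delta> "rot \<theta>" v "4 * K"] \<delta>) auto
qed

lemma rot_orthonormal:
  assumes "x > 0"
  shows "rot 0 x y \<bullet> rot 0 x y = 1" "rot (- (pi / 2)) x y \<bullet> rot (- (pi / 2)) x y = 1"
    "rot 0 x y \<bullet> rot (- (pi / 2)) x y = 0" "u_vec \<phi> Xb 1 y \<bullet> rot \<theta> x y = 0" "V0 x y \<bullet> rot \<theta> x y = 0"
proof -
  show "rot 0 x y \<bullet> rot 0 x y = 1" "rot (- (pi / 2)) x y \<bullet> rot (- (pi / 2)) x y = 1"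
    "rot 0 x y \<bullet> rot (- (pi / 2)) x y = 0"
    using assms by (simp_all add: rot_def cos_diff sin_diff inner_simps inner_frame Q_orthonormal
        flip: power2_eq_square)
  show "u_vec \<phi> Xb 1 y \<bullet> rot \<theta> x y = 0"
    unfolding u_vec_const[OF assms, of y, symmetric]
    using assms by (simp add: rot_def inner_simps u_vec_orthonormal Q_orthonormal)
  have "V0 x y \<bullet> Xa x y = 0" "V0 x y \<bullet> Q x y = 0"
    using assms Q_orthonormal(4)[OF assms, of y]
    by (simp_all add: V0_def inner_simps inner_w inner_frame inner_commute[of _ "Q x y"])
  then show "V0 x y \<bullet> rot \<theta> x y = 0" by (simp add: rot_def inner_simps)
qed

lemma Xa_eq_rot: "Xa x y = cos (sqrt 5 / 2 * ln x) *\<^sub>R rot 0 x y + sin (sqrt 5 / 2 * ln x) *\<^sub>R rot (- (pi / 2)) x y"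
  and Q_eq_rot: "Q x y = - sin (sqrt 5 / 2 * ln x) *\<^sub>R rot 0 x y + cos (sqrt 5 / 2 * ln x) *\<^sub>R rot (- (pi / 2)) x y"
proof -
  define C S where "C = cos (sqrt 5 / 2 * ln x)" and "S = sin (sqrt 5 / 2 * ln x)"
  have one: "C * C + S * S = 1" by (simp add: C_def S_def flip: power2_eq_square)
  have r: "rot 0 x y = C *\<^sub>R Xa x y - S *\<^sub>R Q x y" "rot (- (pi / 2)) x y = S *\<^sub>R Xa x y + C *\<^sub>R Q x y"
    by (simp_all add: rot_def C_def S_def cos_diff sin_diff)
  have "C *\<^sub>R rot 0 x y + S *\<^sub>R rot (- (pi / 2)) x y = (C * C + S * S) *\<^sub>R Xa x y"
    "- S *\<^sub>R rot 0 x y + C *\<^sub>R rot (- (pi / 2)) x y = (C * C + S * S) *\<^sub>R Q x y"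
    by (simp_all add: r algebra_simps)
  then show "Xa x y = cos (sqrt 5 / 2 * ln x) *\<^sub>R rot 0 x y + sin (sqrt 5 / 2 * ln x) *\<^sub>R rot (- (pi / 2)) x y"
    "Q x y = - sin (sqrt 5 / 2 * ln x) *\<^sub>R rot 0 x y + cos (sqrt 5 / 2 * ln x) *\<^sub>R rot (- (pi / 2)) x y"
    by (simp_all only: one scaleR_one C_def[symmetric] S_def[symmetric])
qed

text \<open>\<open>b\<close> and \<open>c\<close> are the limits of the two \<open>rot\<close>
  vectors, which are orthonormal and orthogonal to \<open>u_vec\<close> and \<open>V0\<close> for
  every \<open>x\<close>. The claims on \<open>V0\<close> quantify over any limit \<open>v\<close>,
  since this limit is identified with \<open>v1\<close> only later.\<close>

lemma asymptotic_circle: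
  obtains b c where "norm b = 1" "norm c = 1" "b \<bullet> c = 0"
    "\<forall>y. u_vec \<phi> Xb 1 y \<bullet> b = 0" "\<forall>y. u_vec \<phi> Xb 1 y \<bullet> c = 0"
    "\<forall>x y. 0 < x \<and> x < \<delta> \<longrightarrow> norm (Xa x y - b_circ b c (- ln x)) \<le> 8 * K * x"
    "\<forall>x y. 0 < x \<and> x < \<delta> \<longrightarrow> norm (Q x y + v2_vec b c (- ln x)) \<le> 8 * K * x"
    "\<forall>y v. ((\<lambda>x. V0 x y) \<longlongrightarrow> v) (at_right 0) \<longrightarrow> v \<bullet> b = 0"
    "\<forall>y v. ((\<lambda>x. V0 x y) \<longlongrightarrow> v) (at_right 0) \<longrightarrow> v \<bullet> c = 0"
proof -
  obtain B where B: "\<And>x y. 0 < x \<Longrightarrow> x < \<delta> \<Longrightarrow> norm (rot 0 x y - B y) \<le> 4 * K * x"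
    using rot_limit by metis
  obtain C where C: "\<And>x y. 0 < x \<Longrightarrow> x < \<delta> \<Longrightarrow> norm (rot (- (pi / 2)) x y - C y) \<le> 4 * K * x"
    using rot_limit by metis
  have near: "norm ((a *\<^sub>R rot 0 x y + e *\<^sub>R rot (- (pi / 2)) x y) - (a *\<^sub>R B y + e *\<^sub>R C y)) \<le> 8 * K * x"
    if "0 < x" "x < \<delta>" "\<bar>a\<bar> \<le> 1" "\<bar>e\<bar> \<le> 1" for a e x y
  proof -
    have "(a *\<^sub>R rot 0 x y + e *\<^sub>R rot (- (pi / 2)) x y) - (a *\<^sub>R B y + e *\<^sub>R C y)
        = a *\<^sub>R (rot 0 x y - B y) + e *\<^sub>R (rot (- (pi / 2)) x y - C y)"
      by (simp add: algebra_simps)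
    also have "norm \<dots> \<le> \<bar>a\<bar> * norm (rot 0 x y - B y) + \<bar>e\<bar> * norm (rot (- (pi / 2)) x y - C y)"
      by (rule order_trans[OF norm_triangle_ineq]) simp
    also have "\<dots> \<le> 1 * (4 * K * x) + 1 * (4 * K * x)"
      using that B C by (intro add_mono mult_mono) auto
    finally show ?thesis by simp
  qed
  have Xa: "norm (Xa x y - (cos (sqrt 5 / 2 * ln x) *\<^sub>R B y + sin (sqrt 5 / 2 * ln x) *\<^sub>R C y)) \<le> 8 * K * x"
    if "0 < x" "x < \<delta>" for x y
    by (subst Xa_eq_rot) (intro near that; simp)
  have Q: "norm (Q x y - (- sin (sqrt 5 / 2 * ln x) *\<^sub>R B y + cos (sqrt 5 / 2 * ln x) *\<^sub>R C y)) \<le> 8 * K * x"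
    if "0 < x" "x < \<delta>" for x y
    by (subst Q_eq_rot) (intro near that; simp)
  \<comment> \<open>The vectors \<open>Xa x y\<close> and \<open>Xa x 0\<close> come together as
    \<open>x\<close> tends to 0. Hence the differences of the limits, rotated by
    \<open>sqrt 5 / 2 * ln x\<close>, tend to 0, and so both differences vanish.\<close>
  have const: "B y = B 0 \<and> C y = C 0" for y
  proof -
    have bound: "norm (cos (sqrt 5 / 2 * ln x) *\<^sub>R (B y - B 0) + sin (sqrt 5 / 2 * ln x) *\<^sub>R (C y - C 0))
        \<le> (16 * K + K * \<bar>y - 0\<bar>) * x" if x: "0 < x" "x < \<delta>" for x
    proof -
      let ?L = "\<lambda>y. cos (sqrt 5 / 2 * ln x) *\<^sub>R B y + sin (sqrt 5 / 2 * ln x) *\<^sub>R C y"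
      have "cos (sqrt 5 / 2 * ln x) *\<^sub>R (B y - B 0) + sin (sqrt 5 / 2 * ln x) *\<^sub>R (C y - C 0)
          = (Xa x y - Xa x 0) - (Xa x y - ?L y) + (Xa x 0 - ?L 0)"
        by (simp add: scaleR_diff_right)
      also have "norm \<dots> \<le> norm (Xa x y - Xa x 0) + norm (Xa x y - ?L y) + norm (Xa x 0 - ?L 0)"
        by (intro order_trans[OF norm_triangle_ineq] add_mono norm_triangle_ineq4 order_refl)
      also have "\<dots> \<le> K * \<bar>y - 0\<bar> * x + 8 * K * x + 8 * K * x"
        by (intro add_mono norm_Xa_diff Xa x)
      finally show ?thesis by (simp add: algebra_simps)
    qed
    have "B y - B 0 = 0" "C y - C 0 = 0"
      by (rule zero_if_rotation_vanishes_at_0[OF \<delta>(1) _ bound]; simp)+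
    then show ?thesis by simp
  qed
  define b c where "b = B 0" and "c = C 0"
  have lims: "((\<lambda>x. rot 0 x y) \<longlongrightarrow> b) (at_right 0)" "((\<lambda>x. rot (- (pi / 2)) x y) \<longlongrightarrow> c) (at_right 0)" for y
    unfolding b_def c_def
    using B[of _ y] C[of _ y] const[of y]
    by (auto intro!: tendsto_at_right_0_if_linear_bound[OF \<delta>(1), of _ _ "4 * K"])
  \<comment> \<open>Transfers inner products that are constant for \<open>x > 0\<close> to the
    limit.\<close>
  have unique: "v = r" if "(f \<longlongrightarrow> v) (at_right 0)" "\<And>x. x > 0 \<Longrightarrow> f x = r" for f :: "real \<Rightarrow> real" and v r
  proof (rule tendsto_unique[OF _ that(1)])
    have "\<forall>\<^sub>F x in at_right 0. f x = r"
      using eventually_at_right_less[of "0::real"] by eventually_elim (rule that(2))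
    then show "(f \<longlongrightarrow> r) (at_right 0)" by (rule tendsto_eventually)
  qed simp
  have "b \<bullet> b = 1"
    by (rule unique[where f = "\<lambda>x. rot 0 x 0 \<bullet> rot 0 x 0"]) (auto intro!: tendsto_intros lims simp: rot_orthonormal)
  moreover have "c \<bullet> c = 1"
    by (rule unique[where f = "\<lambda>x. rot (- (pi / 2)) x 0 \<bullet> rot (- (pi / 2)) x 0"]) (auto intro!: tendsto_intros lims simp: rot_orthonormal)
  moreover have "b \<bullet> c = 0"
    by (rule unique[where f = "\<lambda>x. rot 0 x 0 \<bullet> rot (- (pi / 2)) x 0"]) (auto intro!: tendsto_intros lims simp: rot_orthonormal)
  moreover have "u_vec \<phi> Xb 1 y \<bullet> b = 0" for y
    by (rule unique[where f = "\<lambda>x. u_vec \<phi> Xb 1 y \<bullet> rot 0 x y"]) (auto intro!: tendsto_intros lims simp: rot_orthonormal)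
  moreover have "u_vec \<phi> Xb 1 y \<bullet> c = 0" for y
    by (rule unique[where f = "\<lambda>x. u_vec \<phi> Xb 1 y \<bullet> rot (- (pi / 2)) x y"]) (auto intro!: tendsto_intros lims simp: rot_orthonormal)
  moreover have "v \<bullet> b = 0" if "((\<lambda>x. V0 x y) \<longlongrightarrow> v) (at_right 0)" for v y
    by (rule unique[where f = "\<lambda>x. V0 x y \<bullet> rot 0 x y"]) (auto intro!: tendsto_intros lims that simp: rot_orthonormal)
  moreover have "v \<bullet> c = 0" if "((\<lambda>x. V0 x y) \<longlongrightarrow> v) (at_right 0)" for v y
    by (rule unique[where f = "\<lambda>x. V0 x y \<bullet> rot (- (pi / 2)) x y"]) (auto intro!: tendsto_intros lims that simp: rot_orthonormal)
  moreover have "norm (Xa x y - b_circ b c (- ln x)) \<le> 8 * K * x"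
    "norm (Q x y + v2_vec b c (- ln x)) \<le> 8 * K * x" if x: "0 < x" "x < \<delta>" for x y
  proof -
    have "b_circ b c (- ln x) = cos (sqrt 5 / 2 * ln x) *\<^sub>R B y + sin (sqrt 5 / 2 * ln x) *\<^sub>R C y"
      "v2_vec b c (- ln x) = - (- sin (sqrt 5 / 2 * ln x) *\<^sub>R B y + cos (sqrt 5 / 2 * ln x) *\<^sub>R C y)"
      using const[of y] by (simp_all add: b_circ_def v2_vec_def b_def c_def)
    then show "norm (Xa x y - b_circ b c (- ln x)) \<le> 8 * K * x"
      "norm (Q x y + v2_vec b c (- ln x)) \<le> 8 * K * x"
      using Xa[OF x, of y] Q[OF x, of y] by (simp_all only: add_uminus_conv_diff)
  qed
  ultimately show ?thesis
    by (intro that[of b c] allI impI; (elim conjE)?) (simp_all only: norm_eq_1)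
qed

text \<open>\<open>u_vec\<close> does not depend on \<open>x\<close>, so neither does its
  \<open>y\<close>-derivative, and for \<open>y \<noteq> 0\<close> the factor
  \<open>y^2 / (1 + y^2)\<close> can be cancelled. The case \<open>y = 0\<close> follows by
  continuity in \<open>y\<close>.\<close>

lemma V1_const:
  assumes "0 < x" "x < \<delta>"
  shows "V1 x y = V1 (\<delta> / 2) y"
proof -
  have x0: "0 < \<delta> / 2" "\<delta> / 2 < \<delta>" using \<delta> by auto
  have ne: "h x y \<noteq> 0" if "0 < x" "x < \<delta>" for x y using h_pos[OF that, of y] by simp
  have der: "(u_vec \<phi> Xb 1 has_vector_derivative (y\<^sup>2 / (1 + y\<^sup>2)) *\<^sub>R V1 x y) (at y)"
    if "0 < x" "x < \<delta>" for x y
    using u_vec_dy[OF that(1) ne[OF that], of y] u_vec_const[OF that(1)] by simp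
  have eq: "V1 x t = V1 (\<delta> / 2) t" if "t \<noteq> 0" for t
  proof -
    have "1 + t\<^sup>2 \<noteq> 0" using zero_le_power2[of t] by linarith
    then show ?thesis
      using vector_derivative_unique_at[OF der[OF assms, of t] der[OF x0, of t]] that by simp
  qed
  have cont: "continuous_on UNIV (\<lambda>t. V1 x t - V1 (\<delta> / 2) t)"
    by (intro continuous_on_diff continuous_V1 ne assms x0)
  have "((\<lambda>t. V1 x t - V1 (\<delta> / 2) t) \<longlongrightarrow> V1 x 0 - V1 (\<delta> / 2) 0) (at 0)"
    using cont by (simp add: continuous_on_def)
  moreover have "((\<lambda>t. V1 x t - V1 (\<delta> / 2) t) \<longlongrightarrow> 0) (at 0)"
    by (rule tendsto_eventually) (simp add: eventually_at_filter eq)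
  ultimately have "V1 x 0 - V1 (\<delta> / 2) 0 = 0"
    by (rule tendsto_unique[rotated]) simp
  then show ?thesis using eq[of y] by (cases "y = 0") auto
qed

end

section \<open>Convergence of the curvature surface\<close>

text \<open>Both terms have the same \<open>x\<close>-derivative by \<open>f_vec_dx\<close>, so
  their difference is a function of \<open>y\<close> alone; this is \<open>A\<close>.\<close>

lemma (in frame) f0_eq:
  assumes surface: "curvature_surface Xa Xb f0" and "x > 0"
  shows "f0 x y - scale y *\<^sub>R f_vec \<phi> Xb \<xi> x y = f0 1 y - scale y *\<^sub>R f_vec \<phi> Xb \<xi> 1 y"
proof (rule has_vector_derivative_zero_constant_pos[where g = "\<lambda>x. f0 x y - scale y *\<^sub>R f_vec \<phi> Xb \<xi> x y"])
  fix s :: real assume s: "s > 0"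
  have "((\<lambda>(s, t). f0 s t) has_derivative
       (\<lambda>(dx, dy). (dx * ((s\<^sup>2 - y\<^sup>2) / (s * h s y))) *\<^sub>R Xa s y
                   + (dy * (2 * y / h s y)) *\<^sub>R Xb s y)) (at (s, y))"
    using surface s by (auto simp: curvature_surface_def D_def)
  from has_derivative_compose[OF has_derivative_Pair[OF has_derivative_ident has_derivative_const] this]
  have "((\<lambda>s. f0 s y) has_derivative (\<lambda>d. (d * ((s\<^sup>2 - y\<^sup>2) / (s * h s y))) *\<^sub>R Xa s y)) (at s)"
    by simp
  then have "((\<lambda>s. f0 s y) has_vector_derivative ((s\<^sup>2 - y\<^sup>2) / (s * h s y)) *\<^sub>R Xa s y) (at s)"
    by (simp add: has_vector_derivative_def)
  from has_vector_derivative_diff[OF this f_vec_dx[OF s, of y]]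
  show "((\<lambda>x. f0 x y - scale y *\<^sub>R f_vec \<phi> Xb \<xi> x y) has_vector_derivative 0) (at s)"
    by simp
qed (fact assms)

lemma curvature_surface_continuous_y:
  assumes "curvature_surface Xa Xb f0" "x > 0"
  shows "continuous_on UNIV (f0 x)"
proof (rule continuous_at_imp_continuous_on, rule ballI)
  fix y
  have "continuous (at (x, y)) (\<lambda>(s, t). f0 s t)"
    using assms by (auto simp: curvature_surface_def D_def intro: has_derivative_continuous)
  then have "isCont (\<lambda>t. (\<lambda>(s, t). f0 s t) (x, t)) y"
    by (intro continuous_within_compose3[where g = "\<lambda>(s, t). f0 s t" and f = "\<lambda>t. (x, t)"]) (auto intro!: continuous_intros)
  then show "isCont (f0 x) y" by simp
qed

lemma continuous_v2_0: "continuous_on UNIV v2_0" and continuous_v3_0: "continuous_on UNIV v3_0"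
  and continuous_scale: "continuous_on UNIV scale"
proof -
  have h0: "h0 y \<noteq> 0" for y using h0_pos[of y] by simp
  have s: "5 + 4 * y\<^sup>2 \<noteq> 0" "1 + y\<^sup>2 \<noteq> 0" for y :: real using zero_le_power2[of y] by linarith+
  have ch: "continuous_on UNIV h0" unfolding h0_def[abs_def] by (intro continuous_intros)
  show "continuous_on UNIV v2_0" "continuous_on UNIV v3_0" "continuous_on UNIV scale"
    unfolding v2_0_def[abs_def] v3_0_def[abs_def] scale_def[abs_def]
    by (intro continuous_intros ch; use h0 s in simp)+
qed

lemma v3_0_neg: "y \<noteq> 0 \<Longrightarrow> v3_0 y < 0"
  using h0_pos[of y] by (simp add: v3_0_def add_pos_nonneg)

lemma v2_0_at_0: "v2_0 0 = sqrt 5 / 2" and v3_0_at_0: "v3_0 0 = 0" and scale_at_0: "scale 0 = 1 / 2"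
proof -
  define z where "z = 5 + sqrt 5"
  have "z > 0" by (simp add: z_def add_pos_nonneg)
  moreover have "v2_0 0 = 5 * (z / 2) / (sqrt 5 * z)" by (simp add: v2_0_def h0_def z_def)
  ultimately have "v2_0 0 = 5 / sqrt 5 / 2" by simp
  then show "v2_0 0 = sqrt 5 / 2" by (simp add: real_div_sqrt)
  show "v3_0 0 = 0" "scale 0 = 1 / 2" by (simp_all add: v3_0_def scale_def)
qed

text \<open>The upper bound carries the uniform rate for \<open>f_vec\<close> over to
  \<open>f0\<close>.\<close>

lemma scale_pos: "scale y > 0" and scale_le: "scale y \<le> 1 / 2"
proof -
  have q: "1 + y\<^sup>2 > 0" "5 + 4 * y\<^sup>2 > 0" by (simp_all add: add_pos_nonneg)
  then show "scale y > 0" by (simp add: scale_def)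
  have "(5 + 4 * y\<^sup>2) / (1 + y\<^sup>2) \<le> 5" using q by (simp add: pos_divide_le_eq)
  then have "sqrt ((5 + 4 * y\<^sup>2) / (1 + y\<^sup>2)) \<le> sqrt 5" by (rule real_sqrt_le_mono)
  then have "1 / (2 * sqrt 5) * sqrt ((5 + 4 * y\<^sup>2) / (1 + y\<^sup>2)) \<le> 1 / (2 * sqrt 5) * sqrt 5"
    by (rule mult_left_mono) simp
  then show "scale y \<le> 1 / 2" by (simp add: scale_def)
qed

section \<open>Assembly of frame, limit circles and curvature surface\<close>

theorem theorem4p3:
  fixes \<phi> Xa Xb \<xi> f0 :: "real \<Rightarrow> real \<Rightarrow> real ^ 4"
  assumes frame: "frame_field \<phi> Xa Xb \<xi>"
    and surface: "curvature_surface Xa Xb f0"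
  shows "\<exists>(uv :: real \<Rightarrow> real ^ 4) (A :: real \<Rightarrow> real ^ 4).
    (\<forall>x > 0. \<forall>y. u_vec \<phi> Xb x y = uv y) \<and>
    (\<forall>x > 0. \<forall>y. f0 x y = scale y *\<^sub>R f_vec \<phi> Xb \<xi> x y + A y) \<and>
    (\<exists>(b :: real ^ 4) (c :: real ^ 4). norm b = 1 \<and> norm c = 1 \<and> b \<bullet> c = 0 \<and>
      (\<comment> \<open>(1)\<close>
       (\<forall>y. norm (uv y) = 1 \<and> uv y \<bullet> b = 0 \<and> uv y \<bullet> c = 0) \<and>
       (\<exists>v1 :: real \<Rightarrow> real ^ 4.
         continuous_on UNIV v1 \<and>
         (\<forall>y. (uv has_vector_derivative ((y\<^sup>2 / (1 + y\<^sup>2)) *\<^sub>R v1 y)) (at y)) \<and>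
         (\<forall>y. orthonormal4 (uv y) (v1 y) b c) \<and>
         \<comment> \<open>(2)\<close>
         is_circle (range (b_circ b c)) \<and>
         (\<forall>y. u_curve_converges (\<lambda>u y. Xa (exp (- u)) y) (\<lambda>u y. b_circ b c u) y) \<and>
         u_curves_converge_uniformly (\<lambda>u y. Xa (exp (- u)) y) (\<lambda>u y. b_circ b c u) \<and>
         (\<forall>y. u_curve_converges (\<lambda>u y. f_vec \<phi> Xb \<xi> (exp (- u)) y) (a_circ b c v1) y) \<and>
         u_curves_converge_uniformly (\<lambda>u y. f_vec \<phi> Xb \<xi> (exp (- u)) y) (a_circ b c v1) \<and>
         (\<forall>y. y \<noteq> 0 \<longrightarrow> is_circle (range (\<lambda>u. a_circ b c v1 u y))) \<and>
         deforms_continuously (a_circ b c v1) \<and>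
         range (\<lambda>u. a_circ b c v1 u 0) = {- v1 0} \<and>
         \<comment> \<open>(3)\<close>
         (\<forall>y. u_curve_converges (\<lambda>u y. f0 (exp (- u)) y) (Gamma_circ b c v1 A) y) \<and>
         u_curves_converge_uniformly (\<lambda>u y. f0 (exp (- u)) y) (Gamma_circ b c v1 A) \<and>
         (\<forall>y. y \<noteq> 0 \<longrightarrow> is_circle (range (\<lambda>u. Gamma_circ b c v1 A u y))) \<and>
         deforms_continuously (Gamma_circ b c v1 A) \<and>
         range (\<lambda>u. Gamma_circ b c v1 A u 0) = {- (1 / 2) *\<^sub>R v1 0 + A 0})))"
proof -
  interpret frame \<phi> Xa Xb \<xi> by standard (fact frame)
  obtain \<delta> K where \<delta>K: "0 < \<delta>" "\<delta> \<le> 1" "0 \<le> K" and estimates: "\<forall>x y. 0 < x \<and> x < \<delta> \<longrightarrow>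
     1 + y\<^sup>2 \<le> h x y \<and>
     \<bar>k1 x y - sqrt 5 / 2 * be0 y\<bar> \<le> K * x\<^sup>2 \<and> \<bar>l1 x y + sqrt 5 / 2 * al0 y\<bar> \<le> K * x\<^sup>2 \<and>
     \<bar>al x y - al0 y\<bar> \<le> K * x\<^sup>2 \<and> \<bar>be x y - be0 y\<bar> \<le> K * x\<^sup>2 \<and> \<bar>ga x y\<bar> \<le> K * x\<^sup>2"
    by (rule coefficient_estimates) (rule that)
  interpret frame_near_0 \<phi> Xa Xb \<xi> \<delta> K
    by unfold_locales (use \<delta>K in \<open>simp_all only: estimates[rule_format]\<close>)
  define uv where "uv = u_vec \<phi> Xb 1"
  \<comment> \<open>Any \<open>x\<close> between 0 and \<open>\<delta>\<close> yields the same
    vector, by \<open>V1_const\<close>.\<close>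
  define v1 where "v1 = V1 (\<delta> / 2)"
  define A where "A y = f0 1 y - scale y *\<^sub>R f_vec \<phi> Xb \<xi> 1 y" for y
  obtain b c where bc: "norm b = 1" "norm c = 1" "b \<bullet> c = 0"
    and u_bc: "\<forall>y. u_vec \<phi> Xb 1 y \<bullet> b = 0" "\<forall>y. u_vec \<phi> Xb 1 y \<bullet> c = 0"
    and Xa_b: "\<forall>x y. 0 < x \<and> x < \<delta> \<longrightarrow> norm (Xa x y - b_circ b c (- ln x)) \<le> 8 * K * x"
    and Q_v2: "\<forall>x y. 0 < x \<and> x < \<delta> \<longrightarrow> norm (Q x y + v2_vec b c (- ln x)) \<le> 8 * K * x"
    and V0_bc: "\<forall>y v. ((\<lambda>x. V0 x y) \<longlongrightarrow> v) (at_right 0) \<longrightarrow> v \<bullet> b = 0"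
      "\<forall>y v. ((\<lambda>x. V0 x y) \<longlongrightarrow> v) (at_right 0) \<longrightarrow> v \<bullet> c = 0"
    by (rule asymptotic_circle) (rule that)
  have x0: "0 < \<delta> / 2" "\<delta> / 2 < \<delta>" using \<delta> by auto
  have h_x0: "h (\<delta> / 2) y \<noteq> 0" for y using h_pos[OF x0, of y] by simp

  \<comment> \<open>\<open>V1\<close> stays equal to \<open>v1\<close> while its coefficients
    approach those of \<open>V0\<close>, so \<open>v1\<close> is the limit of
    \<open>V0\<close>.\<close>
  have V0_v1: "norm (V0 x y - v1 y) \<le> 3 * K * x" if "0 < x" "x < \<delta>" for x y
    using norm_V1_minus_V0[OF that, of y] V1_const[OF that, of y]
    by (simp add: v1_def norm_minus_commute)
  have "((\<lambda>x. V0 x y) \<longlongrightarrow> v1 y) (at_right 0)" for y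
    by (rule tendsto_at_right_0_if_linear_bound[where g = "\<lambda>x. V0 x y" and L = "v1 y", OF \<delta>(1) V0_v1])
  note v1_bc = V0_bc[rule_format, OF this]
  have uv_norm: "norm (uv y) = 1" for y
    by (simp add: uv_def norm_eq_1 u_vec_orthonormal)
  have uv_v1: "uv y \<bullet> v1 y = 0" for y
    using V1_orthonormal(2)[OF x0(1) h_x0] u_vec_const[OF x0(1)] by (simp add: uv_def v1_def)
  have v1_norm: "norm (v1 y) = 1" for y
    using V1_orthonormal(1)[OF x0(1) h_x0] by (simp add: v1_def norm_eq_1)
  have v1_cont: "continuous_on UNIV v1"
    unfolding v1_def by (rule continuous_V1[OF x0(1) h_x0])

  \<comment> \<open>Both coefficients are at most 3 in absolute value, and the errors are
    \<open>3 * K * x\<close> for \<open>V0\<close> and \<open>8 * K * x\<close> for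
    \<open>Q\<close>; this explains \<open>33 = 3 * 3 + 3 * 8\<close>.\<close>
  have f_a: "norm (f_vec \<phi> Xb \<xi> x y - a_circ b c v1 (- ln x) y) \<le> 33 * K * x"
    if x: "0 < x" "x < \<delta>" for x y
  proof -
    define r s where "r = 2 / sqrt 5 * v2_0 y" and "s = 2 / sqrt 5 * v3_0 y"
    have rs: "\<bar>r\<bar> \<le> 3" "\<bar>s\<bar> \<le> 3" using abs_v2_0_le abs_v3_0_le by (simp_all only: r_def s_def)
    have "f_vec \<phi> Xb \<xi> x y - a_circ b c v1 (- ln x) y
        = - (r *\<^sub>R (V0 x y - v1 y) + s *\<^sub>R (Q x y + v2_vec b c (- ln x)))"
      unfolding f_vec_eq_V0_Q a_circ_def by (simp add: r_def s_def algebra_simps)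
    then have "norm (f_vec \<phi> Xb \<xi> x y - a_circ b c v1 (- ln x) y)
        \<le> \<bar>r\<bar> * norm (V0 x y - v1 y) + \<bar>s\<bar> * norm (Q x y + v2_vec b c (- ln x))"
      by (simp only: norm_minus_cancel) (rule order_trans[OF norm_triangle_ineq], simp)
    also have "\<dots> \<le> 3 * (3 * K * x) + 3 * (8 * K * x)"
      using rs V0_v1[OF x] Q_v2[rule_format, OF conjI, OF x] by (intro add_mono mult_mono) auto
    finally show ?thesis by simp
  qed
  have f0: "f0 x y = scale y *\<^sub>R f_vec \<phi> Xb \<xi> x y + A y" if "x > 0" for x y
    using f0_eq[OF surface that, of y] by (simp add: A_def algebra_simps)
  have f0_Gamma: "norm (f0 x y - Gamma_circ b c v1 A (- ln x) y) \<le> 33 * K * x"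
    if x: "0 < x" "x < \<delta>" for x y
  proof -
    have "f0 x y - Gamma_circ b c v1 A (- ln x) y
        = scale y *\<^sub>R (f_vec \<phi> Xb \<xi> x y - a_circ b c v1 (- ln x) y)"
      by (simp add: f0[OF x(1)] Gamma_circ_def scaleR_diff_right)
    then have "norm (f0 x y - Gamma_circ b c v1 A (- ln x) y)
        = scale y * norm (f_vec \<phi> Xb \<xi> x y - a_circ b c v1 (- ln x) y)"
      using scale_pos[of y] by simp
    also have "\<dots> \<le> 1 * (33 * K * x)"
      using f_a[OF x] scale_pos[of y] scale_le[of y] by (intro mult_mono) auto
    finally show ?thesis by simp
  qed

  \<comment> \<open>The affine form in \<open>v2_vec\<close>, here and in \<open>G_eq\<close>,
    matches the lemmas on circles and on continuous deformation.\<close>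
  have a_eq: "a_circ b c v1 = (\<lambda>u y. (- (2 / sqrt 5 * v2_0 y)) *\<^sub>R v1 y + (2 / sqrt 5 * v3_0 y) *\<^sub>R v2_vec b c u)"
    by (simp add: fun_eq_iff a_circ_def algebra_simps)
  have G_eq: "Gamma_circ b c v1 A = (\<lambda>u y.
      (scale y *\<^sub>R (- (2 / sqrt 5 * v2_0 y)) *\<^sub>R v1 y + A y) + (scale y * (2 / sqrt 5 * v3_0 y)) *\<^sub>R v2_vec b c u)"
    by (simp add: fun_eq_iff Gamma_circ_def a_eq scaleR_add_right scaleR_diff_right)
  have f_vec_cont: "continuous_on UNIV (f_vec \<phi> Xb \<xi> 1)"
  proof -
    have "(1 + y\<^sup>2) * (5 + 4 * y\<^sup>2) \<noteq> 0" for y :: real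
      using zero_le_power2[of y] by (simp add: add_nonneg_eq_0_iff)
    then show ?thesis
      unfolding f_vec_def[abs_def] by (intro continuous_intros continuous_frame) auto
  qed
  have A_cont: "continuous_on UNIV A"
    unfolding A_def[abs_def]
    by (intro continuous_intros curvature_surface_continuous_y[OF surface] continuous_scale f_vec_cont) simp

  have 1: "\<forall>x>0. \<forall>y. u_vec \<phi> Xb x y = uv y"
    unfolding uv_def using u_vec_const by blast
  have 2: "\<forall>x>0. \<forall>y. f0 x y = scale y *\<^sub>R f_vec \<phi> Xb \<xi> x y + A y"
    using f0 by simp
  have 3: "\<forall>y. norm (uv y) = 1 \<and> uv y \<bullet> b = 0 \<and> uv y \<bullet> c = 0"
    using uv_norm u_bc by (simp add: uv_def)
  have 4: "\<forall>y. (uv has_vector_derivative ((y\<^sup>2 / (1 + y\<^sup>2)) *\<^sub>R v1 y)) (at y)"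
    using u_vec_dy[OF x0(1) h_x0] u_vec_const[OF x0(1)] by (simp add: uv_def v1_def)
  have 5: "\<forall>y. orthonormal4 (uv y) (v1 y) b c"
    using uv_norm v1_norm uv_v1 u_bc v1_bc bc by (simp add: orthonormal4_def uv_def)
  have 6: "u_curves_converge_uniformly (\<lambda>u y. Xa (exp (- u)) y) (\<lambda>u y. b_circ b c u)"
    by (rule u_curves_converge_uniformlyI[where M = "Xa" and N = "\<lambda>u y. b_circ b c u" and C = "8 * K", OF \<delta>(1)])
      (use K Xa_b[rule_format, OF conjI] in simp_all)
  have 7: "u_curves_converge_uniformly (\<lambda>u y. f_vec \<phi> Xb \<xi> (exp (- u)) y) (a_circ b c v1)"
    by (rule u_curves_converge_uniformlyI[where M = "f_vec \<phi> Xb \<xi>" and N = "a_circ b c v1" and C = "33 * K", OF \<delta>(1)])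
      (use K f_a in simp_all)
  have 8: "u_curves_converge_uniformly (\<lambda>u y. f0 (exp (- u)) y) (Gamma_circ b c v1 A)"
    by (rule u_curves_converge_uniformlyI[where M = "f0" and N = "Gamma_circ b c v1 A" and C = "33 * K", OF \<delta>(1)])
      (use K f0_Gamma in simp_all)
  have 9: "\<forall>y. y \<noteq> 0 \<longrightarrow> is_circle (range (\<lambda>u. a_circ b c v1 u y))"
    unfolding a_eq using v3_0_neg
    by (intro allI impI is_circle_range_v2_vec bc mult_pos_neg) auto
  have 10: "\<forall>y. y \<noteq> 0 \<longrightarrow> is_circle (range (\<lambda>u. Gamma_circ b c v1 A u y))"
    unfolding G_eq using v3_0_neg scale_pos
    by (intro allI impI is_circle_range_v2_vec bc mult_pos_neg) auto
  have 11: "deforms_continuously (a_circ b c v1)"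
    unfolding a_eq
    by (intro deforms_continuously_affine_v2_vec bc continuous_intros continuous_v2_0 continuous_v3_0 v1_cont) auto
  have 12: "deforms_continuously (Gamma_circ b c v1 A)"
    unfolding G_eq
    by (intro deforms_continuously_affine_v2_vec bc continuous_intros continuous_v2_0 continuous_v3_0
        continuous_scale v1_cont A_cont) auto
  \<comment> \<open>At \<open>y = 0\<close> the radius vanishes because \<open>v3_0 0 = 0\<close>,
    and \<open>v2_0 0 = sqrt 5 / 2\<close> leaves \<open>- v1 0\<close>.\<close>
  have 13: "range (\<lambda>u. a_circ b c v1 u 0) = {- v1 0}"
    by (auto simp: a_circ_def v2_0_at_0 v3_0_at_0)
  have 14: "range (\<lambda>u. Gamma_circ b c v1 A u 0) = {- (1 / 2) *\<^sub>R v1 0 + A 0}"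
    by (auto simp: Gamma_circ_def a_circ_def v2_0_at_0 v3_0_at_0 scale_at_0)
  have 15: "is_circle (range (b_circ b c))"
    by (rule is_circle_range_b_circ[OF bc])
  note pointwise = 6[THEN u_curve_converges_if_uniformly, THEN allI]
    7[THEN u_curve_converges_if_uniformly, THEN allI] 8[THEN u_curve_converges_if_uniformly, THEN allI]
  show ?thesis
    by (rule exI[of _ uv], rule exI[of _ A], intro conjI, rule 1, rule 2,
        rule exI[of _ b], rule exI[of _ c], intro conjI, (rule bc)+, rule 3,
        rule exI[of _ v1], intro conjI; (rule v1_cont 4 5 6 7 8 9 10 11 12 13 14 15 pointwise))
qed

end
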